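(* Let $E$ be an energy form of full support on $L^0(m)$. For $h\in L^0(m)$ the following assertions are equivalent. (i) $h$ is $E$-excessive. (ii) For all $f\in D(E)$ the inequality $E(f\wedge h)\le E(f)$ holds.
   Context: $(X,\mathcal B,m)$ is a measure space with $m$ localizable: $m$ is semi-finite and every family $\mathcal A\subseteq\mathcal B$ has an essential supremum $S\in\mathcal B$, i.e. $m(A\setminus S)=0$ for all $A\in\mathcal A$, and $m(S\setminus G)=0$ whenever $G\in\mathcal B$ satisfies $m(A\setminus G)=0$ for all $A\in\mathcal A$. $L^0(m)$ is the space of real-valued measurable functions modulo $m$-a.e. equality, with the topology $\tau(m)$ of local convergence in measure: $f_i\to f$ iff $\int_U|f_i-f|\wedge1\,dm\to0$ for every measurable $U$ with $m(U)<\infty$; $f\wedge h=\min\{f,h\}$. A quadratic form on $L^0(m)$ is a map $q:L^0(m)\to[0,\infty]$ with $2q(u)+2q(v)=q(u+v)+q(u-v)$ and $q(\lambda u)=|\lambda|^2q(u)$ ($0\cdot\infty=0$); $D(q)=\{q<\infty\}$, and $q(u,v)=\frac14(q(u+v)-q(u-v))$ is the induced bilinear form on $D(q)$. It is closed if $D(q)$ is complete in the form topology, the smallest topology containing the subspace topology of $\tau(m)$ and the topology of the seminorm $q^{1/2}$. An $\varepsilon$-cutoff is a monotone increasing map $C:\mathbb R\to[-\varepsilon,1+\varepsilon]$ with $|C(x)-C(y)|\le|x-y|$ and $C(x)=x$ for $x\in[0,1]$. A quadratic form $E$ on $L^0(m)$ is Markovian if for each $\varepsilon>0$ there is an $\varepsilon$-cutoff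 $C_\varepsilon$ with $E(C_\varepsilon\circ f)\le E(f)$ for all $f\in L^0(m)$; an energy form is a closed Markovian form on $L^0(m)$. A function $h\in D(E)$ is $E$-superharmonic if $E(h,\psi)\ge0$ for all nonnegative $\psi\in D(E)$; a function in $L^0(m)$ is $E$-excessive if it belongs to the $\tau(m)$-closure of the set of $E$-superharmonic functions. $E$ has full support if $X$ is an essential supremum of the family $\{\{|f|\ge\alpha\}: f\in D(E),\ \alpha>0\}$. *)

theory Defs
  imports "HOL-Analysis.Analysis"
begin

section \<open>Localizable measures\<close>

definition ess_supremum :: "'a measure \<Rightarrow> 'a set set \<Rightarrow> 'a set \<Rightarrow> bool" where
  "ess_supremum M \<A> S \<longleftrightarrow>
     S \<in> sets M \<and> (\<forall>A\<in>\<A>. emeasure M (A - S) = 0) \<and>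
     (\<forall>G\<in>sets M. (\<forall>A\<in>\<A>. emeasure M (A - G) = 0) \<longrightarrow> emeasure M (S - G) = 0)"

definition semifinite_measure :: "'a measure \<Rightarrow> bool" where
  "semifinite_measure M \<longleftrightarrow>
     (\<forall>A\<in>sets M. emeasure M A = \<infinity> \<longrightarrow>
        (\<exists>B\<in>sets M. B \<subseteq> A \<and> 0 < emeasure M B \<and> emeasure M B < \<infinity>))"

definition localizable :: "'a measure \<Rightarrow> bool" where
  "localizable M \<longleftrightarrow>
     semifinite_measure M \<and> (\<forall>\<A>\<subseteq>sets M. \<exists>S. ess_supremum M \<A> S)"

section \<open>Local convergence in measure\<close>

text \<open>
  An element of \<open>L\<^sup>0(m)\<close> is represented by any of its representatives, i.e. by an element of
  \<open>borel_measurable M\<close>. Maps on \<open>L\<^sup>0(m)\<close> are maps that respect almost everywhere equality, and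
  topologies on \<open>L\<^sup>0(m)\<close> are pulled back along the quotient map. In particular the topologies
  below need not be Hausdorff: limits are unique only up to almost everywhere equality.
\<close>

definition local_dist :: "'a measure \<Rightarrow> 'a set \<Rightarrow> ('a \<Rightarrow> real) \<Rightarrow> ('a \<Rightarrow> real) \<Rightarrow> real" where
  "local_dist M U f g = (\<integral>x\<in>U. min \<bar>f x - g x\<bar> 1 \<partial>M)"

definition local_measure_topology :: "'a measure \<Rightarrow> ('a \<Rightarrow> real) topology" where
  "local_measure_topology M =
     topology_generated_by
       {{g \<in> borel_measurable M. local_dist M U g f < r} | U f r.
          U \<in> fmeasurable M \<and> f \<in> borel_measurable M \<and> 0 < r}"

lemma local_dist_integrable:
  fixes f g :: "'a \<Rightarrow> real"
  assumes "U \<in> fmeasurable M" "f \<in> borel_measurable M" "g \<in> borel_measurable M"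
  shows "set_integrable M U (\<lambda>x. min \<bar>f x - g x\<bar> 1)"
proof -
  have *: "integrable M (indicator U :: _ \<Rightarrow> real)"
    using assms(1) by (simp add: fmeasurable_def)
  have [measurable]: "U \<in> sets M" "f \<in> borel_measurable M" "g \<in> borel_measurable M"
    using assms by auto
  show ?thesis
    unfolding set_integrable_def
    by (rule Bochner_Integration.integrable_bound[OF *]) (auto split: split_indicator)
qed

lemma local_dist_triangle:
  assumes "U \<in> fmeasurable M" "f \<in> borel_measurable M" "g \<in> borel_measurable M"
    "h \<in> borel_measurable M"
  shows "local_dist M U f h \<le> local_dist M U f g + local_dist M U g h"
proof -
  have "local_dist M U f h \<le> (\<integral>x\<in>U. (min \<bar>f x - g x\<bar> 1) + (min \<bar>g x - h x\<bar> 1) \<partial>M)"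
    unfolding local_dist_def
    by (intro set_integral_mono set_integral_add local_dist_integrable assms) linarith
  also have "\<dots> = local_dist M U f g + local_dist M U g h"
    unfolding local_dist_def
    by (intro set_integral_add local_dist_integrable assms)
  finally show ?thesis .
qed

lemma local_dist_nonneg: "0 \<le> local_dist M U f g"
  unfolding local_dist_def set_lebesgue_integral_def
  by (intro Bochner_Integration.integral_nonneg) (auto split: split_indicator)

lemma local_dist_self [simp]: "local_dist M U f f = 0"
  by (simp add: local_dist_def)

lemma topspace_local_measure_topology [simp]:
  "topspace (local_measure_topology M) = borel_measurable M"
proof -
  have "{g \<in> borel_measurable M. local_dist M {} g (\<lambda>_. 0) < 1} = borel_measurable M"
    by (simp add: local_dist_def set_lebesgue_integral_def)
  moreover have "openin (local_measure_topology M)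
      {g \<in> borel_measurable M. local_dist M {} g (\<lambda>_. 0) < 1}"
    unfolding local_measure_topology_def
    by (rule topology_generated_by_Basis, rule CollectI, intro exI conjI, rule refl) simp_all
  ultimately have "borel_measurable M \<subseteq> topspace (local_measure_topology M)"
    by (metis openin_subset)
  moreover have "topspace (local_measure_topology M) \<subseteq> borel_measurable M"
    unfolding local_measure_topology_def topology_generated_by_topspace by blast
  ultimately show ?thesis by (rule subset_antisym[rotated])
qed

lemma limitin_local_measure_topology:
  "limitin (local_measure_topology M) f l F \<longleftrightarrow>
     l \<in> borel_measurable M \<and> (\<forall>\<^sub>F i in F. f i \<in> borel_measurable M) \<and>
     (\<forall>U\<in>fmeasurable M. ((\<lambda>i. local_dist M U (f i) l) \<longlongrightarrow> 0) F)"
    (is "?L \<longleftrightarrow> ?R")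
proof
  assume L: ?L
  then have l: "l \<in> borel_measurable M"
    by (metis limitin_topspace topspace_local_measure_topology)
  have ball: "\<forall>\<^sub>F i in F. f i \<in> borel_measurable M \<and> local_dist M U (f i) l < r"
    if "U \<in> fmeasurable M" "0 < r" for U r
  proof -
    have "openin (local_measure_topology M) {g \<in> borel_measurable M. local_dist M U g l < r}"
      unfolding local_measure_topology_def using that l
      by (intro topology_generated_by_Basis) blast
    moreover have "l \<in> {g \<in> borel_measurable M. local_dist M U g l < r}"
      using that l by simp
    ultimately have "\<forall>\<^sub>F i in F. f i \<in> {g \<in> borel_measurable M. local_dist M U g l < r}"
      using L unfolding limitin_def by blast
    then show ?thesis by simp
  qed
  have "\<forall>\<^sub>F i in F. f i \<in> borel_measurable M"
    by (rule eventually_mono[OF ball[of "{}" 1]]) simp_all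
  moreover have "((\<lambda>i. local_dist M U (f i) l) \<longlongrightarrow> 0) F" if "U \<in> fmeasurable M" for U
  proof (rule tendstoI)
    fix r :: real assume "0 < r"
    from ball[OF that this] show "\<forall>\<^sub>F i in F. dist (local_dist M U (f i) l) 0 < r"
      by (rule eventually_mono) (simp add: dist_real_def local_dist_nonneg)
  qed
  ultimately show ?R using l by blast
next
  assume R: ?R
  have "\<forall>\<^sub>F i in F. f i \<in> V"
    if V: "generate_topology_on
       {{g \<in> borel_measurable M. local_dist M U g f < r} | U f r.
          U \<in> fmeasurable M \<and> f \<in> borel_measurable M \<and> 0 < r} V" and "l \<in> V" for V
    using V \<open>l \<in> V\<close>
  proof (induction rule: generate_topology_on.induct)
    case Empty
    then show ?case by simp
  next
    case (Int a b)
    then show ?case by (simp add: eventually_conj_iff)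
  next
    case (UN K)
    then obtain k where "k \<in> K" "l \<in> k" by blast
    with UN.IH have "\<forall>\<^sub>F i in F. f i \<in> k" by blast
    then show ?case by (rule eventually_mono) (use \<open>k \<in> K\<close> in blast)
  next
    case (Basis s)
    then obtain U g r where s: "s = {u \<in> borel_measurable M. local_dist M U u g < r}"
      and U: "U \<in> fmeasurable M" and g: "g \<in> borel_measurable M" by blast
    have pos: "0 < r - local_dist M U l g" using Basis s by simp
    have "((\<lambda>i. local_dist M U (f i) l) \<longlongrightarrow> 0) F" using R U by blast
    then have "\<forall>\<^sub>F i in F. local_dist M U (f i) l < r - local_dist M U l g"
      using pos by (rule order_tendstoD(2))
    moreover have "\<forall>\<^sub>F i in F. f i \<in> borel_measurable M" using R by blast
    ultimately show ?case
    proof eventually_elim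
      case (elim i)
      then show ?case
        using local_dist_triangle[OF U, of "f i" l g] R g s by simp
    qed
  qed
  then show ?L
    using R unfolding limitin_def topspace_local_measure_topology
    by (simp add: local_measure_topology_def openin_topology_generated_by_iff)
qed

section \<open>Closed quadratic forms\<close>

definition quadratic_form :: "'a measure \<Rightarrow> (('a \<Rightarrow> real) \<Rightarrow> ennreal) \<Rightarrow> bool" where
  "quadratic_form M q \<longleftrightarrow>
     (\<forall>u\<in>borel_measurable M. \<forall>v\<in>borel_measurable M. (AE x in M. u x = v x) \<longrightarrow> q u = q v) \<and>
     (\<forall>u\<in>borel_measurable M. \<forall>v\<in>borel_measurable M.
        2 * q u + 2 * q v = q (\<lambda>x. u x + v x) + q (\<lambda>x. u x - v x)) \<and>
     (\<forall>u\<in>borel_measurable M. \<forall>c::real. q (\<lambda>x. c * u x) = ennreal (\<bar>c\<bar>\<^sup>2) * q u)"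

definition form_domain :: "'a measure \<Rightarrow> (('a \<Rightarrow> real) \<Rightarrow> ennreal) \<Rightarrow> ('a \<Rightarrow> real) set" where
  "form_domain M q = {u \<in> borel_measurable M. q u < \<infinity>}"

text \<open>Only meaningful for \<open>u, v \<in> form_domain M q\<close>.\<close>
definition form_bilinear :: "(('a \<Rightarrow> real) \<Rightarrow> ennreal) \<Rightarrow> ('a \<Rightarrow> real) \<Rightarrow> ('a \<Rightarrow> real) \<Rightarrow> real" where
  "form_bilinear q u v =
     (enn2real (q (\<lambda>x. u x + v x)) - enn2real (q (\<lambda>x. u x - v x))) / 4"

definition form_seminorm_topology ::
    "'a measure \<Rightarrow> (('a \<Rightarrow> real) \<Rightarrow> ennreal) \<Rightarrow> ('a \<Rightarrow> real) topology" where
  "form_seminorm_topology M q =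
     topology_generated_by
       {{g \<in> form_domain M q. sqrt (enn2real (q (\<lambda>x. g x - f x))) < r} | f r.
          f \<in> form_domain M q \<and> 0 < r}"

definition form_topology ::
    "'a measure \<Rightarrow> (('a \<Rightarrow> real) \<Rightarrow> ennreal) \<Rightarrow> ('a \<Rightarrow> real) topology" where
  "form_topology M q =
     topology_generated_by
       ({V. openin (subtopology (local_measure_topology M) (form_domain M q)) V} \<union>
        {V. openin (form_seminorm_topology M q) V})"

text \<open>
  Completeness as a topological vector space, stated with Cauchy filters because the topology
  need not be metrizable: every proper filter \<open>F\<close> on the space for which \<open>f - g \<rightarrow> 0\<close> along
  \<open>F \<times> F\<close> has a limit.
\<close>
definition complete_function_space :: "('a \<Rightarrow> real) topology \<Rightarrow> bool" where
  "complete_function_space T \<longleftrightarrow>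
     (\<forall>F. F \<noteq> bot \<and> F \<le> principal (topspace T) \<and>
          limitin T (\<lambda>(f, g). (\<lambda>x. f x - g x)) (\<lambda>x. 0) (F \<times>\<^sub>F F) \<longrightarrow>
        (\<exists>l. limitin T (\<lambda>f. f) l F))"

lemma topspace_form_topology [simp]: "topspace (form_topology M q) = form_domain M q"
proof -
  have "\<Union>{V. openin (subtopology (local_measure_topology M) (form_domain M q)) V} =
      topspace (subtopology (local_measure_topology M) (form_domain M q))"
    by (auto simp: topspace_def)
  also have "\<dots> = form_domain M q"
    by (auto simp: form_domain_def)
  finally have 1: "\<Union>{V. openin (subtopology (local_measure_topology M) (form_domain M q)) V} =
    form_domain M q" .
  have "V \<subseteq> form_domain M q" if "openin (form_seminorm_topology M q) V" for V
    using openin_subset[OF that]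
    by (auto simp: form_seminorm_topology_def)
  with 1 show ?thesis
    unfolding form_topology_def topology_generated_by_topspace by blast
qed

definition closed_form :: "'a measure \<Rightarrow> (('a \<Rightarrow> real) \<Rightarrow> ennreal) \<Rightarrow> bool" where
  "closed_form M q \<longleftrightarrow> complete_function_space (form_topology M q)"

section \<open>Energy forms\<close>

definition cutoff :: "real \<Rightarrow> (real \<Rightarrow> real) \<Rightarrow> bool" where
  "cutoff \<epsilon> C \<longleftrightarrow>
     mono C \<and> range C \<subseteq> {-\<epsilon>..1 + \<epsilon>} \<and> (\<forall>x y. \<bar>C x - C y\<bar> \<le> \<bar>x - y\<bar>) \<and> (\<forall>x\<in>{0..1}. C x = x)"

definition Markovian :: "'a measure \<Rightarrow> (('a \<Rightarrow> real) \<Rightarrow> ennreal) \<Rightarrow> bool" where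
  "Markovian M E \<longleftrightarrow>
     (\<forall>\<epsilon>>0. \<exists>C. cutoff \<epsilon> C \<and> (\<forall>f\<in>borel_measurable M. E (C \<circ> f) \<le> E f))"

definition energy_form :: "'a measure \<Rightarrow> (('a \<Rightarrow> real) \<Rightarrow> ennreal) \<Rightarrow> bool" where
  "energy_form M E \<longleftrightarrow> quadratic_form M E \<and> closed_form M E \<and> Markovian M E"

definition full_support :: "'a measure \<Rightarrow> (('a \<Rightarrow> real) \<Rightarrow> ennreal) \<Rightarrow> bool" where
  "full_support M E \<longleftrightarrow>
     ess_supremum M {{x \<in> space M. \<bar>f x\<bar> \<ge> \<alpha>} | f \<alpha>. f \<in> form_domain M E \<and> \<alpha> > 0} (space M)"

definition superharmonic :: "'a measure \<Rightarrow> (('a \<Rightarrow> real) \<Rightarrow> ennreal) \<Rightarrow> ('a \<Rightarrow> real) \<Rightarrow> bool" where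
  "superharmonic M E h \<longleftrightarrow>
     h \<in> form_domain M E \<and>
     (\<forall>\<psi>\<in>form_domain M E. (AE x in M. 0 \<le> \<psi> x) \<longrightarrow> form_bilinear E h \<psi> \<ge> 0)"

definition excessive :: "'a measure \<Rightarrow> (('a \<Rightarrow> real) \<Rightarrow> ennreal) \<Rightarrow> ('a \<Rightarrow> real) \<Rightarrow> bool" where
  "excessive M E h \<longleftrightarrow> h \<in> local_measure_topology M closure_of {u. superharmonic M E u}"

end

theory Submission
  imports Defs
begin

text \<open>
  A closed form is lower semicontinuous for local convergence in measure. Hence normal contractions
  reduce energy, and \<open>E (f \<and> u) \<le> E f\<close> for superharmonic \<open>u\<close> passes to limits of
  superharmonic functions. Conversely, if \<open>h\<close> reduces energies, a minimiser of \<open>E\<close> among the functions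
  between \<open>f \<and> h\<close> and \<open>h\<close> exists, and it is superharmonic because adding a nonnegative function
  and cutting off at \<open>h\<close> leads back into this order interval. Full support provides \<open>f\<close> for which
  \<open>f \<and> h\<close>, hence also the minimiser, is close to \<open>h\<close> on a given set of finite measure.
\<close>

section \<open>Quadratic forms\<close>

text \<open>Three obstacles shape the proof. The sets of finite measure need not have a countable
  cofinal family, so local convergence in measure need not be metrizable, and completeness has to be
  exploited through filters. It need not be locally convex either, so closed convex sets give no
  direct route from completeness to semicontinuity. Finally, \<open>E\<close> may vanish on nonzero
  functions, so energy alone does not control a function and a minimiser cannot be found by Hilbert
  space projection; pointwise monotone limits trapped between two fixed functions take its place.
  The function \<open>h\<close> may have infinite energy. It therefore enters only through
  truncations \<open>min (f x) (h x)\<close>, which the inequality in (ii) puts back into the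
  domain. To see \<open>h\<close> almost everywhere on a set of finite measure, it is truncated by
  \<open>real n * f n x\<close>, where \<open>f n\<close> increases and is eventually positive: the
  multiples overtake any finite value of \<open>h\<close>.\<close>

lemma limitin_topology_generated_byI:
  assumes l: "l \<in> \<Union>S" and ev: "\<And>s. s \<in> S \<Longrightarrow> l \<in> s \<Longrightarrow> \<forall>\<^sub>F i in F. f i \<in> s"
  shows "limitin (topology_generated_by S) f l F"
proof -
  have "\<forall>\<^sub>F i in F. f i \<in> V" if "generate_topology_on S V" "l \<in> V" for V
    using that
  proof (induction rule: generate_topology_on.induct)
    case (Int a b)
    then show ?case by (simp add: eventually_conj_iff)
  next
    case (UN K)
    then obtain k where "k \<in> K" "l \<in> k" by blast
    with UN.IH have "\<forall>\<^sub>F i in F. f i \<in> k" by blast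
    then show ?case by (rule eventually_mono) (use \<open>k \<in> K\<close> in blast)
  qed (auto intro: ev)
  then show ?thesis
    using l by (simp add: limitin_def openin_topology_generated_by_iff)
qed

locale local_quadratic_form =
  fixes M :: "'a measure" and E :: "('a \<Rightarrow> real) \<Rightarrow> ennreal"
  assumes form: "quadratic_form M E"
begin

abbreviation D :: "('a \<Rightarrow> real) set" where "D \<equiv> form_domain M E"
abbreviation Q :: "('a \<Rightarrow> real) \<Rightarrow> real" where "Q u \<equiv> enn2real (E u)"
abbreviation B :: "('a \<Rightarrow> real) \<Rightarrow> ('a \<Rightarrow> real) \<Rightarrow> real" where "B \<equiv> form_bilinear E"

lemma D_measurable: "u \<in> D \<Longrightarrow> u \<in> borel_measurable M"
  by (simp add: form_domain_def)

lemma ennreal_Q: "u \<in> D \<Longrightarrow> ennreal (Q u) = E u"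
  by (simp add: form_domain_def)

lemma domainI_le: "u \<in> borel_measurable M \<Longrightarrow> E u \<le> ennreal c \<Longrightarrow> u \<in> D"
  by (auto simp: form_domain_def intro: le_less_trans)

lemma Q_le: "E u \<le> ennreal c \<Longrightarrow> 0 \<le> c \<Longrightarrow> Q u \<le> c"
  using enn2real_mono[of "E u" "ennreal c"] by simp

lemma Q_mono: "v \<in> D \<Longrightarrow> E u \<le> E v \<Longrightarrow> Q u \<le> Q v"
  by (auto simp: form_domain_def intro: enn2real_mono)

lemma E_le_iff: "u \<in> D \<Longrightarrow> v \<in> D \<Longrightarrow> E u \<le> E v \<longleftrightarrow> Q u \<le> Q v"
  by (metis ennreal_Q ennreal_le_iff enn2real_nonneg)

lemma E_AE_cong:
  "u \<in> borel_measurable M \<Longrightarrow> v \<in> borel_measurable M \<Longrightarrow> AE x in M. u x = v x \<Longrightarrow> E u = E v"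
  using form unfolding quadratic_form_def by blast

lemma E_parallelogram:
  "u \<in> borel_measurable M \<Longrightarrow> v \<in> borel_measurable M \<Longrightarrow>
    2 * E u + 2 * E v = E (\<lambda>x. u x + v x) + E (\<lambda>x. u x - v x)"
  using form unfolding quadratic_form_def by blast

lemma E_scale: "u \<in> borel_measurable M \<Longrightarrow> E (\<lambda>x. c * u x) = ennreal (c\<^sup>2) * E u"
  using form unfolding quadratic_form_def by (metis power2_abs)

text \<open>Both energies are summands of the right-hand side of the parallelogram identity, whose
  left-hand side is finite.\<close>

lemma D_add_diff:
  assumes "u \<in> D" "v \<in> D"
  shows "(\<lambda>x. u x + v x) \<in> D" "(\<lambda>x. u x - v x) \<in> D"
proof -
  have [measurable]: "u \<in> borel_measurable M" "v \<in> borel_measurable M"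
    using assms by (auto simp: D_measurable)
  have "2 * E u + 2 * E v < \<infinity>"
    using assms by (simp add: form_domain_def ennreal_mult_less_top)
  then have "E (\<lambda>x. u x + v x) + E (\<lambda>x. u x - v x) < \<infinity>"
    by (simp add: E_parallelogram)
  then show "(\<lambda>x. u x + v x) \<in> D" "(\<lambda>x. u x - v x) \<in> D"
    by (auto simp: form_domain_def)
qed

lemma D_scale: "u \<in> D \<Longrightarrow> (\<lambda>x. c * u x) \<in> D"
  by (auto simp: form_domain_def E_scale ennreal_mult_less_top)

lemma D_divide: "u \<in> D \<Longrightarrow> (\<lambda>x. u x / c) \<in> D"
  using D_scale[of u "1 / c"] by simp

lemma D_minus: "u \<in> D \<Longrightarrow> (\<lambda>x. - u x) \<in> D"
  using D_scale[of u "-1"] by simp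

lemma D_zero: "(\<lambda>x. 0) \<in> D"
  using E_scale[of "\<lambda>x. 0" 0] by (simp add: form_domain_def)

lemmas D_intros = D_add_diff D_scale D_divide D_minus D_zero

lemma Q_parallelogram:
  assumes "u \<in> D" "v \<in> D"
  shows "Q (\<lambda>x. u x + v x) + Q (\<lambda>x. u x - v x) = 2 * Q u + 2 * Q v"
proof -
  have "ennreal (2 * Q u + 2 * Q v) = ennreal (Q (\<lambda>x. u x + v x) + Q (\<lambda>x. u x - v x))"
    using E_parallelogram[of u v] assms
    by (simp add: ennreal_mult ennreal_Q D_intros D_measurable)
  then show ?thesis by (subst (asm) ennreal_inj) simp_all
qed

lemma Q_scale: "u \<in> D \<Longrightarrow> Q (\<lambda>x. c * u x) = c\<^sup>2 * Q u"
  by (simp add: E_scale D_measurable enn2real_mult)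

lemma Q_minus: "u \<in> D \<Longrightarrow> Q (\<lambda>x. - u x) = Q u"
  using Q_scale[of u "-1"] by simp

lemma Q_zero: "Q (\<lambda>x. 0) = 0"
  using E_scale[of "\<lambda>x. 0" 0] by simp

lemma Q_minus_commute:
  assumes "u \<in> D" "v \<in> D"
  shows "Q (\<lambda>x. u x - v x) = Q (\<lambda>x. v x - u x)"
  using Q_minus[OF D_add_diff(2)[OF assms]] by simp

lemma Q_add:
  assumes "u \<in> D" "v \<in> D"
  shows "Q (\<lambda>x. u x + v x) = Q u + 2 * B u v + Q v"
  using Q_parallelogram[OF assms] by (simp add: form_bilinear_def field_simps)

lemma B_commute: "u \<in> D \<Longrightarrow> v \<in> D \<Longrightarrow> B u v = B v u"
  using Q_minus_commute[of u v] by (simp add: form_bilinear_def add.commute)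

lemma B_zero_left: "v \<in> D \<Longrightarrow> B (\<lambda>x. 0) v = 0"
  by (simp add: form_bilinear_def Q_minus)

text \<open>The Jordan-von Neumann argument: subtracting the parallelogram identities for the pairs
  \<open>u + w\<close>, \<open>v + w\<close> and \<open>u - w\<close>, \<open>v - w\<close> cancels
  \<open>Q (u - v)\<close> and leaves additivity up to a factor 2 in the second argument.\<close>

lemma B_add_left:
  assumes u: "u \<in> D" and v: "v \<in> D" and w: "w \<in> D"
  shows "B (\<lambda>x. u x + v x) w = B u w + B v w"
proof -
  have half: "B u w + B v w = B (\<lambda>x. u x + v x) (\<lambda>x. 2 * w x) / 2" if "u \<in> D" "v \<in> D" for u v
  proof -
    have "Q (\<lambda>x. (u x + w x) + (v x + w x)) + Q (\<lambda>x. (u x + w x) - (v x + w x))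
        = 2 * Q (\<lambda>x. u x + w x) + 2 * Q (\<lambda>x. v x + w x)"
      by (intro Q_parallelogram D_intros that w)
    moreover have "Q (\<lambda>x. (u x - w x) + (v x - w x)) + Q (\<lambda>x. (u x - w x) - (v x - w x))
        = 2 * Q (\<lambda>x. u x - w x) + 2 * Q (\<lambda>x. v x - w x)"
      by (intro Q_parallelogram D_intros that w)
    moreover have "(\<lambda>x. (u x + w x) + (v x + w x)) = (\<lambda>x. u x + v x + 2 * w x)"
      "(\<lambda>x. (u x - w x) + (v x - w x)) = (\<lambda>x. u x + v x - 2 * w x)"
      by (auto simp: fun_eq_iff)
    ultimately show ?thesis
      by (simp add: form_bilinear_def field_simps)
  qed
  \<comment> \<open>The pair \<open>u + v\<close>, \<open>0\<close> in \<open>half\<close> removes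
    the factor 2.\<close>
  have "B (\<lambda>x. u x + v x) (\<lambda>x. 2 * w x) / 2 = B (\<lambda>x. u x + v x) w"
    using half[OF D_add_diff(1)[OF u v] D_zero] by (simp add: B_zero_left w)
  with half[OF u v] show ?thesis by simp
qed

text \<open>An additive function of a real variable that is bounded near the origin is linear.\<close>
lemma B_scale_left:
  assumes u: "u \<in> D" and w: "w \<in> D"
  shows "B (\<lambda>x. t * u x) w = t * B u w"
proof -
  \<comment> \<open>The deviation from linearity is additive and vanishes at 1, hence has period 1.
    A bound on the unit interval thus holds everywhere, and since
    \<open>\<phi> (n * t) = n * \<phi> t\<close> it forces \<open>\<phi> t = 0\<close>.\<close>
  define \<phi> where "\<phi> s = B (\<lambda>x. s * u x) w - s * B u w" for s
  have add: "\<phi> (s + t) = \<phi> s + \<phi> t" for s t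
    using B_add_left[OF D_scale[OF u, of s] D_scale[OF u, of t] w]
    by (simp add: \<phi>_def distrib_right algebra_simps)
  have zero: "\<phi> 0 = 0" using add[of 0 0] by simp
  have mult: "\<phi> (real n * s) = real n * \<phi> s" for n s
    by (induction n) (simp_all add: zero add distrib_right)
  have one: "\<phi> 1 = 0" by (simp add: \<phi>_def)
  have neg: "\<phi> (- s) = - \<phi> s" for s
    using add[of s "- s"] zero by simp
  have int: "\<phi> (of_int k) = 0" for k
  proof (cases "0 \<le> k")
    case True
    then show ?thesis using mult[of "nat k" 1] one by simp
  next
    case False
    then show ?thesis using mult[of "nat (- k)" 1] one neg[of "of_int k"] by simp
  qed
  \<comment> \<open>The first summand bounds \<open>B (r * u) w\<close> for \<open>r\<close> in the
    unit interval. It comes from the parallelogram identity, as the Cauchy-Schwarz inequality is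
    derived from homogeneity only later.\<close>
  define K where "K = (Q u + Q w) / 2 + \<bar>B u w\<bar>"
  have "\<bar>\<phi> s\<bar> \<le> K" for s
  proof -
    have "\<phi> s = \<phi> (frac s + of_int \<lfloor>s\<rfloor>)" by (simp add: frac_def)
    also have "\<dots> = \<phi> (frac s)" by (simp only: add int)
    finally have eq: "\<phi> s = \<phi> (frac s)" .
    define r where "r = frac s"
    have r: "0 \<le> r" "r \<le> 1" unfolding r_def using frac_lt_1[of s] by auto
    have "Q (\<lambda>x. r * u x + w x) + Q (\<lambda>x. r * u x - w x) = 2 * (r\<^sup>2 * Q u) + 2 * Q w"
      using Q_parallelogram[OF D_scale[OF u] w] by (simp add: Q_scale u)
    moreover have "r\<^sup>2 * Q u \<le> 1 * Q u"
      by (rule mult_right_mono) (use r in \<open>auto simp: power_le_one\<close>)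
    moreover have "\<bar>a - b\<bar> \<le> 2 * (d + e)"
      if "a + b = 2 * c + 2 * e" "c \<le> 1 * d" "0 \<le> a" "0 \<le> b" for a b c d e :: real
      using that by (auto simp: abs_le_iff)
    ultimately have "\<bar>Q (\<lambda>x. r * u x + w x) - Q (\<lambda>x. r * u x - w x)\<bar> \<le> 2 * (Q u + Q w)"
      using enn2real_nonneg by blast
    then have "\<bar>B (\<lambda>x. r * u x) w\<bar> \<le> (Q u + Q w) / 2"
      by (simp add: form_bilinear_def)
    moreover have "\<bar>r * B u w\<bar> \<le> \<bar>B u w\<bar>"
      using r by (simp add: abs_mult mult_left_le_one_le)
    ultimately have "\<bar>\<phi> r\<bar> \<le> K"
      unfolding \<phi>_def K_def by linarith
    then show ?thesis by (simp add: eq r_def)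
  qed
  then have "real n * \<bar>\<phi> t\<bar> \<le> K" for n
    using mult[of n t] by (metis abs_mult abs_of_nat)
  then have "\<bar>\<phi> t\<bar> \<le> 0"
    by (meson not_le reals_Archimedean3)
  then show ?thesis by (simp add: \<phi>_def)
qed

lemma B_diff_left:
  assumes "u \<in> D" "v \<in> D" "w \<in> D"
  shows "B (\<lambda>x. u x - v x) w = B u w - B v w"
  using B_add_left[OF assms(1) D_scale[OF assms(2), of "-1"] assms(3)]
    B_scale_left[OF assms(2,3), of "-1"] by simp

lemma Q_add_scale:
  assumes "u \<in> D" "v \<in> D"
  shows "Q (\<lambda>x. u x + t * v x) = Q u + 2 * t * B u v + t\<^sup>2 * Q v"
  using Q_add[OF assms(1) D_scale[OF assms(2), of t]] B_scale_left[OF assms(2,1), of t]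
    B_commute[OF assms] B_commute[OF assms(1) D_scale[OF assms(2), of t]] assms
  by (simp add: Q_scale)

lemma Cauchy_Schwarz:
  assumes "u \<in> D" "v \<in> D"
  shows "(B u v)\<^sup>2 \<le> Q u * Q v"
proof -
  have pos: "0 \<le> Q u + 2 * t * B u v + t\<^sup>2 * Q v" for t
    using Q_add_scale[OF assms, of t] by (metis enn2real_nonneg)
  show ?thesis
  proof (cases "Q v = 0")
    case True
    have "B u v = 0"
    proof (rule ccontr)
      \<comment> \<open>For \<open>Q v = 0\<close> the polynomial in \<open>t\<close> is affine;
        this \<open>t\<close> gives it the value -1.\<close>
      assume "B u v \<noteq> 0"
      then have "2 * (- (Q u + 1) / (2 * B u v)) * B u v = - (Q u + 1)" by simp
      with pos[of "- (Q u + 1) / (2 * B u v)"] True show False by simp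
    qed
    then show ?thesis by simp
  next
    case False
    then have v: "0 < Q v" using enn2real_nonneg[of "E v"] by linarith
    \<comment> \<open>Evaluation at the vertex of the parabola.\<close>
    have "Q u + 2 * (- B u v / Q v) * B u v + (- B u v / Q v)\<^sup>2 * Q v = Q u - (B u v)\<^sup>2 / Q v"
      using v by (simp add: power2_eq_square field_simps)
    with pos[of "- B u v / Q v"] have "(B u v)\<^sup>2 / Q v \<le> Q u" by simp
    then show ?thesis using v by (simp add: field_simps)
  qed
qed

lemma sqrt_Q_triangle:
  assumes "u \<in> D" "v \<in> D"
  shows "sqrt (Q (\<lambda>x. u x + v x)) \<le> sqrt (Q u) + sqrt (Q v)"
proof (rule real_le_lsqrt)
  have "B u v \<le> sqrt (Q u * Q v)"
    using Cauchy_Schwarz[OF assms] real_le_rsqrt by blast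
  then show "Q (\<lambda>x. u x + v x) \<le> (sqrt (Q u) + sqrt (Q v))\<^sup>2"
    by (simp add: Q_add assms power2_sum real_sqrt_mult)
qed auto

lemma sqrt_Q_diff_triangle:
  assumes "u \<in> D" "v \<in> D" "w \<in> D"
  shows "sqrt (Q (\<lambda>x. u x - w x)) \<le> sqrt (Q (\<lambda>x. u x - v x)) + sqrt (Q (\<lambda>x. v x - w x))"
  using sqrt_Q_triangle[OF D_add_diff(2)[OF assms(1,2)] D_add_diff(2)[OF assms(2,3)]] by simp

section \<open>Convergence in the form topology\<close>

text \<open>The subbasic seminorm balls have arbitrary centres; the triangle inequality for
  \<open>sqrt (Q u)\<close> reduces them to distances from the limit.\<close>

lemma limitin_form_topologyI:
  assumes l: "l \<in> D" and ev: "\<forall>\<^sub>F i in F. f i \<in> D"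
    and dist: "\<And>U. U \<in> fmeasurable M \<Longrightarrow> ((\<lambda>i. local_dist M U (f i) l) \<longlongrightarrow> 0) F"
    and energy: "((\<lambda>i. Q (\<lambda>x. f i x - l x)) \<longlongrightarrow> 0) F"
  shows "limitin (form_topology M E) f l F"
proof -
  have "limitin (local_measure_topology M) f l F"
    unfolding limitin_local_measure_topology
    using l ev dist by (auto simp: D_measurable elim: eventually_mono)
  then have 1: "limitin (subtopology (local_measure_topology M) D) f l F"
    using l ev by (simp add: limitin_subtopology)
  have sq: "((\<lambda>i. sqrt (Q (\<lambda>x. f i x - l x))) \<longlongrightarrow> 0) F"
    using tendsto_real_sqrt[OF energy] by simp
  have 2: "limitin (form_seminorm_topology M E) f l F"
    unfolding form_seminorm_topology_def
  proof (rule limitin_topology_generated_byI)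
    have "l \<in> {g \<in> D. sqrt (Q (\<lambda>x. g x - l x)) < 1}"
      using l by (simp add: Q_zero)
    then show "l \<in> \<Union> {{g \<in> D. sqrt (Q (\<lambda>x. g x - f x)) < r} |f r. f \<in> D \<and> 0 < r}"
      using l zero_less_one by blast
  next
    fix s assume "s \<in> {{g \<in> D. sqrt (Q (\<lambda>x. g x - f x)) < r} |f r. f \<in> D \<and> 0 < r}" "l \<in> s"
    then obtain g r where g: "g \<in> D" and s: "s = {u \<in> D. sqrt (Q (\<lambda>x. u x - g x)) < r}" by blast
    have "0 < r - sqrt (Q (\<lambda>x. l x - g x))" using \<open>l \<in> s\<close> s by simp
    from order_tendstoD(2)[OF sq this] ev show "\<forall>\<^sub>F i in F. f i \<in> s"
    proof eventually_elim
      case (elim i)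
      then show ?case using sqrt_Q_diff_triangle[of "f i" l g] l g s by simp
    qed
  qed
  show ?thesis
    unfolding form_topology_def
  proof (rule limitin_topology_generated_byI)
    show "l \<in> \<Union> ({V. openin (subtopology (local_measure_topology M) D) V} \<union>
               {V. openin (form_seminorm_topology M E) V})"
      using limitin_topspace[OF 2] openin_topspace by blast
  qed (use 1 2 in \<open>auto simp: limitin_def\<close>)
qed

lemma limitin_form_topologyD:
  assumes lim: "limitin (form_topology M E) f l F"
  shows "l \<in> D" "\<forall>\<^sub>F i in F. f i \<in> D"
    "\<And>U. U \<in> fmeasurable M \<Longrightarrow> ((\<lambda>i. local_dist M U (f i) l) \<longlongrightarrow> 0) F"
    "((\<lambda>i. Q (\<lambda>x. f i x - l x)) \<longlongrightarrow> 0) F"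
proof -
  show l: "l \<in> D"
    using limitin_topspace[OF lim] by simp
  have ev: "\<forall>\<^sub>F i in F. f i \<in> V"
    if "openin (subtopology (local_measure_topology M) D) V \<or>
      openin (form_seminorm_topology M E) V" "l \<in> V" for V
    using lim that unfolding limitin_def form_topology_def
    by (metis (mono_tags, lifting) UnCI mem_Collect_eq topology_generated_by_Basis)
  have "openin (subtopology (local_measure_topology M) D) D"
    using openin_topspace[of "subtopology (local_measure_topology M) D"]
    by (simp add: form_domain_def Int_absorb1 subset_iff)
  with l ev show ev_D: "\<forall>\<^sub>F i in F. f i \<in> D" by blast
  have "limitin (subtopology (local_measure_topology M) D) f l F"
    unfolding limitin_def using l ev by (auto simp: D_measurable)
  then have "limitin (local_measure_topology M) f l F"
    by (simp add: limitin_subtopology)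
  then show "((\<lambda>i. local_dist M U (f i) l) \<longlongrightarrow> 0) F" if "U \<in> fmeasurable M" for U
    using that by (simp add: limitin_local_measure_topology)
  show "((\<lambda>i. Q (\<lambda>x. f i x - l x)) \<longlongrightarrow> 0) F"
  proof (rule tendstoI)
    fix e :: real assume e: "0 < e"
    have "openin (form_seminorm_topology M E) {g \<in> D. sqrt (Q (\<lambda>x. g x - l x)) < sqrt e}"
      unfolding form_seminorm_topology_def
      by (rule topology_generated_by_Basis, rule CollectI, intro exI conjI, rule refl)
        (use l e in simp_all)
    moreover have "l \<in> {g \<in> D. sqrt (Q (\<lambda>x. g x - l x)) < sqrt e}"
      using l e by (simp add: Q_zero)
    ultimately have "\<forall>\<^sub>F i in F. f i \<in> {g \<in> D. sqrt (Q (\<lambda>x. g x - l x)) < sqrt e}"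
      using ev by blast
    then show "\<forall>\<^sub>F i in F. dist (Q (\<lambda>x. f i x - l x)) 0 < e"
      by (rule eventually_mono) (simp add: dist_real_def)
  qed
qed

end

section \<open>Lower semicontinuity of closed forms\<close>

lemma local_dist_commute: "local_dist M U f g = local_dist M U g f"
  by (simp add: local_dist_def abs_minus_commute)

lemma local_dist_diff_zero: "local_dist M U (\<lambda>x. f x - g x) (\<lambda>x. 0) = local_dist M U f g"
  by (simp add: local_dist_def)

lemma local_dist_mono_set:
  assumes "U \<subseteq> V" "U \<in> fmeasurable M" "V \<in> fmeasurable M"
    "f \<in> borel_measurable M" "g \<in> borel_measurable M"
  shows "local_dist M U f g \<le> local_dist M V f g"
  unfolding local_dist_def set_lebesgue_integral_def
  using assms(1) local_dist_integrable[OF assms(2,4,5)] local_dist_integrable[OF assms(3,4,5)]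
  by (intro integral_mono) (auto simp: set_integrable_def split: split_indicator)

lemma local_dist_mono:
  assumes "U \<in> fmeasurable M" "f \<in> borel_measurable M" "g \<in> borel_measurable M"
    "f' \<in> borel_measurable M" "g' \<in> borel_measurable M"
    "\<And>x. \<bar>f x - g x\<bar> \<le> \<bar>f' x - g' x\<bar>"
  shows "local_dist M U f g \<le> local_dist M U f' g'"
  unfolding local_dist_def
  by (intro set_integral_mono local_dist_integrable assms min.mono order_refl)

text \<open>The local distances are not convex, but this bound on midpoints replaces convexity.\<close>
lemma local_dist_midpoint:
  assumes "U \<in> fmeasurable M" "f \<in> borel_measurable M" "g \<in> borel_measurable M"
    "h \<in> borel_measurable M"
  shows "local_dist M U (\<lambda>x. 1/2 * (f x + g x)) h \<le> local_dist M U f h + local_dist M U g h"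
proof -
  have "local_dist M U (\<lambda>x. 1/2 * (f x + g x)) h
      \<le> (\<integral>x\<in>U. (min \<bar>f x - h x\<bar> 1) + (min \<bar>g x - h x\<bar> 1) \<partial>M)"
    unfolding local_dist_def
  proof (intro set_integral_mono set_integral_add local_dist_integrable assms)
    show "(\<lambda>x. 1/2 * (f x + g x)) \<in> borel_measurable M" using assms by measurable
  next
    fix x
    show "min \<bar>1/2 * (f x + g x) - h x\<bar> 1 \<le> min \<bar>f x - h x\<bar> 1 + min \<bar>g x - h x\<bar> 1"
      by (auto simp: min_def abs_if field_simps)
  qed
  also have "\<dots> = local_dist M U f h + local_dist M U g h"
    unfolding local_dist_def
    by (intro set_integral_add local_dist_integrable assms)
  finally show ?thesis .
qed

text \<open>Dominated convergence: the truncation at 1 and the finite measure of \<open>U\<close>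
  make \<open>indicator U\<close> an integrable majorant.\<close>

lemma local_dist_tendsto_zero:
  fixes f :: "nat \<Rightarrow> 'a \<Rightarrow> real"
  assumes U: "U \<in> fmeasurable M" and f: "\<And>n. f n \<in> borel_measurable M"
    and g: "g \<in> borel_measurable M"
    and lim: "AE x in M. x \<in> U \<longrightarrow> (\<lambda>n. f n x) \<longlonglongrightarrow> g x"
  shows "(\<lambda>n. local_dist M U (f n) g) \<longlonglongrightarrow> 0"
proof -
  have [measurable]: "U \<in> sets M" "f n \<in> borel_measurable M" "g \<in> borel_measurable M" for n
    using assms by auto
  have "(\<lambda>n. \<integral>x. indicator U x *\<^sub>R min \<bar>f n x - g x\<bar> 1 \<partial>M) \<longlonglongrightarrow> (\<integral>x. 0 \<partial>M)"
  proof (rule integral_dominated_convergence[where w = "indicator U"])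
    show "integrable M (indicator U :: _ \<Rightarrow> real)"
      using U by (simp add: fmeasurable_def)
    show "AE x in M. (\<lambda>n. indicator U x *\<^sub>R min \<bar>f n x - g x\<bar> 1) \<longlonglongrightarrow> 0"
      using lim
    proof (rule AE_mp, intro AE_I2 impI)
      fix x assume *: "x \<in> U \<longrightarrow> (\<lambda>n. f n x) \<longlonglongrightarrow> g x"
      show "(\<lambda>n. indicator U x *\<^sub>R min \<bar>f n x - g x\<bar> 1) \<longlonglongrightarrow> 0"
      proof (cases "x \<in> U")
        case True
        with * have "(\<lambda>n. \<bar>f n x - g x\<bar>) \<longlonglongrightarrow> 0"
          by (simp add: LIM_zero_iff tendsto_rabs_zero_iff)
        from tendsto_min[OF this tendsto_const[of 1]] True show ?thesis by simp
      qed simp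
    qed
  qed (auto split: split_indicator)
  then show ?thesis
    by (simp add: local_dist_def set_lebesgue_integral_def)
qed

text \<open>Finite-measure subsets of the set where \<open>f\<close> and \<open>g\<close> differ are
  null. By semi-finiteness that set cannot have infinite measure, since it would then contain a
  subset of positive finite measure.\<close>

lemma AE_eq_of_local_dist_zero:
  assumes sf: "semifinite_measure M" and f: "f \<in> borel_measurable M" and g: "g \<in> borel_measurable M"
    and zero: "\<And>U. U \<in> fmeasurable M \<Longrightarrow> local_dist M U f g = 0"
  shows "AE x in M. f x = g x"
proof -
  define N where "N = {x \<in> space M. f x \<noteq> g x}"
  have [measurable]: "N \<in> sets M" unfolding N_def using f g by measurable
  have null: "emeasure M U = 0" if "U \<subseteq> N" "U \<in> fmeasurable M" for U
  proof -
    have [measurable]: "U \<in> sets M" using that by auto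
    have "integrable M (\<lambda>x. indicator U x * min \<bar>f x - g x\<bar> 1)"
      using local_dist_integrable[OF that(2) f g] by (simp add: set_integrable_def)
    moreover have "(\<integral>x. indicator U x * min \<bar>f x - g x\<bar> 1 \<partial>M) = 0"
      using zero[OF that(2)] by (simp add: local_dist_def set_lebesgue_integral_def)
    ultimately have "AE x in M. indicator U x * min \<bar>f x - g x\<bar> 1 = 0"
      by (subst (asm) integral_nonneg_eq_0_iff_AE) auto
    then have "AE x in M. x \<notin> U"
      by (rule AE_mp) (use that(1) in \<open>auto simp: N_def indicator_def min_def split: if_splits\<close>)
    then show ?thesis by (subst (asm) AE_iff_measurable[of U]) (auto dest: sets.sets_into_space[OF \<open>U \<in> sets M\<close>, THEN subsetD])
  qed
  have "emeasure M N = 0"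
  proof (cases "emeasure M N = \<infinity>")
    case True
    then obtain V where V: "V \<in> sets M" "V \<subseteq> N" "0 < emeasure M V" "emeasure M V < \<infinity>"
      using sf unfolding semifinite_measure_def by (meson \<open>N \<in> sets M\<close>)
    then have "V \<in> fmeasurable M" by (auto intro: fmeasurableI)
    with null[of V] V show ?thesis by simp
  next
    case False
    then have "N \<in> fmeasurable M" by (intro fmeasurableI) (auto simp: less_top)
    then show ?thesis using null by blast
  qed
  then show ?thesis
    using \<open>N \<in> sets M\<close> by (subst AE_iff_measurable[of N]) (auto simp: N_def)
qed

text \<open>A single ball centred at \<open>h\<close> suffices: two such balls contain the one for
  \<open>U \<union> U'\<close> with the smaller radius, and balls with other centres are recentred
  by the triangle inequality.\<close>

lemma local_measure_topology_basis:
  assumes "openin (local_measure_topology M) V" "h \<in> V"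
  shows "\<exists>U\<in>fmeasurable M. \<exists>r>0. {g \<in> borel_measurable M. local_dist M U g h < r} \<subseteq> V"
  using assms unfolding local_measure_topology_def openin_topology_generated_by_iff
proof (induction rule: generate_topology_on.induct)
  case Empty
  then show ?case by simp
next
  case (Int V W)
  then obtain U r U' r' where U: "U \<in> fmeasurable M" "0 < r"
      "{g \<in> borel_measurable M. local_dist M U g h < r} \<subseteq> V"
    and U': "U' \<in> fmeasurable M" "0 < r'"
      "{g \<in> borel_measurable M. local_dist M U' g h < r'} \<subseteq> W" by blast
  have "openin (local_measure_topology M) V"
    using Int.hyps(1) unfolding local_measure_topology_def openin_topology_generated_by_iff .
  from openin_subset[OF this] Int.prems have h: "h \<in> borel_measurable M"
    by auto
  have "g \<in> V \<inter> W"
    if "g \<in> borel_measurable M" "local_dist M (U \<union> U') g h < min r r'" for g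
  proof -
    have "local_dist M U g h \<le> local_dist M (U \<union> U') g h"
      "local_dist M U' g h \<le> local_dist M (U \<union> U') g h"
      using that U(1) U'(1) h by (auto intro!: local_dist_mono_set)
    with that U(3) U'(3) show ?thesis by auto
  qed
  then have "{g \<in> borel_measurable M. local_dist M (U \<union> U') g h < min r r'} \<subseteq> V \<inter> W" by blast
  moreover have "U \<union> U' \<in> fmeasurable M" "0 < min r r'" using U U' by auto
  ultimately show ?case by blast
next
  case (UN K)
  then obtain V where V: "V \<in> K" "h \<in> V" by blast
  with UN.IH obtain U r where "U \<in> fmeasurable M" "0 < r"
    "{g \<in> borel_measurable M. local_dist M U g h < r} \<subseteq> V" by blast
  with V(1) show ?case by blast
next
  case (Basis s)
  then obtain U f r where s: "s = {g \<in> borel_measurable M. local_dist M U g f < r}"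
    and U: "U \<in> fmeasurable M" and f: "f \<in> borel_measurable M" by blast
  have h: "h \<in> borel_measurable M" "0 < r - local_dist M U h f" using Basis s by auto
  have "{g \<in> borel_measurable M. local_dist M U g h < r - local_dist M U h f} \<subseteq> s"
  proof
    fix g assume g: "g \<in> {g \<in> borel_measurable M. local_dist M U g h < r - local_dist M U h f}"
    then show "g \<in> s" using local_dist_triangle[OF U _ h(1) f, of g] s by auto
  qed
  then show ?case using U h(2) by blast
qed

lemma in_closure_local_measure_iff:
  assumes h: "h \<in> borel_measurable M" and S: "S \<subseteq> borel_measurable M"
  shows "h \<in> local_measure_topology M closure_of S \<longleftrightarrow>
    (\<forall>U\<in>fmeasurable M. \<forall>r>0. \<exists>u\<in>S. local_dist M U u h < r)"
proof (intro iffI ballI allI impI)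
  fix U and r :: real
  assume cl: "h \<in> local_measure_topology M closure_of S" and U: "U \<in> fmeasurable M" and r: "0 < r"
  have "openin (local_measure_topology M) {g \<in> borel_measurable M. local_dist M U g h < r}"
    unfolding local_measure_topology_def using U r h
    by (intro topology_generated_by_Basis) blast
  moreover have "h \<in> {g \<in> borel_measurable M. local_dist M U g h < r}" using h r by simp
  ultimately obtain u where "u \<in> S" "u \<in> {g \<in> borel_measurable M. local_dist M U g h < r}"
    using cl unfolding in_closure_of by meson
  then show "\<exists>u\<in>S. local_dist M U u h < r" by auto
next
  assume *: "\<forall>U\<in>fmeasurable M. \<forall>r>0. \<exists>u\<in>S. local_dist M U u h < r"
  show "h \<in> local_measure_topology M closure_of S"
    unfolding in_closure_of
  proof (intro conjI allI impI)
    show "h \<in> topspace (local_measure_topology M)" using h by simp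
    fix V assume "h \<in> V \<and> openin (local_measure_topology M) V"
    then have "openin (local_measure_topology M) V" "h \<in> V" by simp_all
    from local_measure_topology_basis[OF this] obtain U r where U: "U \<in> fmeasurable M" "0 < r"
      and V: "{g \<in> borel_measurable M. local_dist M U g h < r} \<subseteq> V"
      by blast
    from * U obtain u where "u \<in> S" "local_dist M U u h < r" by meson
    with V S show "\<exists>u. u \<in> S \<and> u \<in> V" by auto
  qed
qed

locale closed_local_form = local_quadratic_form +
  assumes closed: "closed_form M E" and semifinite: "semifinite_measure M"
begin

text \<open>
  With the least possible bound \<open>a\<close>, the functions \<open>g\<close> close to \<open>f\<close> with \<open>Q g \<le> a + e\<close> form a
  filter, which is Cauchy by the parallelogram identity because midpoints stay close to \<open>f\<close>.
\<close>
lemma lower_semicontinuous: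
  assumes f: "f \<in> borel_measurable M"
    and approx: "\<And>U e. U \<in> fmeasurable M \<Longrightarrow> 0 < e \<Longrightarrow>
      \<exists>g\<in>borel_measurable M. local_dist M U g f < e \<and> E g \<le> C"
  shows "E f \<le> C"
proof (cases C)
  case top
  then show ?thesis by simp
next
  case (real c)
  \<comment> \<open>\<open>H b\<close> says that \<open>f\<close> is in the closure of the sublevel
    set of \<open>Q\<close> at \<open>b\<close>. The infimum \<open>a\<close> of such
    \<open>b\<close> is the value at \<open>f\<close> of the lower semicontinuous envelope of
    \<open>Q\<close>.\<close>
  define H where "H b \<longleftrightarrow> (\<forall>U\<in>fmeasurable M. \<forall>e>0. \<exists>g\<in>D. local_dist M U g f < e \<and> Q g \<le> b)" for b
  have empty: "{} \<in> fmeasurable M" by simp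
  have Hc: "H c"
    unfolding H_def using approx real by (metis Q_le domainI_le)
  have H_nonneg: "0 \<le> b" if "H b" for b
    using that zero_less_one empty enn2real_nonneg order_trans
    unfolding H_def by metis
  define a where "a = Inf {b. H b}"
  have bdd: "bdd_below {b. H b}" using H_nonneg by (auto intro: bdd_belowI[of _ 0])
  have a_c: "a \<le> c" unfolding a_def by (rule cInf_lower) (use Hc bdd in auto)
  have a_nonneg: "0 \<le> a" unfolding a_def by (rule cInf_greatest) (use Hc H_nonneg in auto)
  have H_above: "H (a + \<delta>)" if "0 < \<delta>" for \<delta>
  proof -
    have "{b. H b} \<noteq> {}" "Inf {b. H b} < a + \<delta>" using Hc that by (auto simp: a_def)
    from cInf_lessD[OF this] obtain b where "H b" "b < a + \<delta>" by blast
    then show ?thesis unfolding H_def by (meson less_imp_le order_trans)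
  qed
  have not_H: "\<not> H (a - \<delta>)" if "0 < \<delta>" for \<delta>
    using cInf_lower[OF _ bdd, of "a - \<delta>"] that by (auto simp: a_def)

  \<comment> \<open>The second component of \<open>p\<close> is both the radius and the slack in
    energy.\<close>
  define A where "A p = {g \<in> D. local_dist M (fst p) g f < snd p \<and> Q g \<le> a + snd p}"
    for p :: "'a set \<times> real"
  define I where "I = fmeasurable M \<times> {0::real<..}"
  define F where "F = (INF p\<in>I. principal (A p))"
  have A_nonempty: "A p \<noteq> {}" if "p \<in> I" for p
    using that H_above[of "snd p"] unfolding A_def I_def H_def by fastforce
  have A_directed: "\<exists>r\<in>I. A r \<subseteq> A p \<inter> A q" if "p \<in> I" "q \<in> I" for p q
  proof (intro bexI subsetI)
    let ?r = "(fst p \<union> fst q, min (snd p) (snd q))"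
    show r: "?r \<in> I" using that by (auto simp: I_def)
    fix g assume g: "g \<in> A ?r"
    then have gm: "g \<in> borel_measurable M" by (auto simp: A_def D_measurable)
    have "local_dist M (fst p) g f \<le> local_dist M (fst ?r) g f"
      "local_dist M (fst q) g f \<le> local_dist M (fst ?r) g f"
      using that r by (auto intro!: local_dist_mono_set gm f simp: I_def)
    with g show "g \<in> A p \<inter> A q" by (auto simp: A_def)
  qed
  have ev_F: "eventually P F \<longleftrightarrow> (\<exists>p\<in>I. \<forall>g\<in>A p. P g)" for P
  proof -
    have "I \<noteq> {}" unfolding I_def using empty zero_less_one by blast
    then show ?thesis
      unfolding F_def
      by (subst eventually_INF_base) (use A_directed in \<open>auto simp: eventually_principal\<close>)
  qed
  have F_bot: "F \<noteq> bot"
    using A_nonempty by (auto simp: trivial_limit_def ev_F)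
  have ev_A: "\<forall>\<^sub>F g in F. g \<in> A (U, e)" if "U \<in> fmeasurable M" "0 < e" for U e
    using that by (auto simp: ev_F I_def)
  have ev_D: "\<forall>\<^sub>F g in F. g \<in> D"
    using ev_A[OF empty zero_less_one] by (rule eventually_mono) (simp add: A_def)
  have ev_Q: "\<exists>U\<in>fmeasurable M. \<exists>e>0. \<forall>g\<in>A (U, e). \<forall>g'\<in>A (U, e). Q (\<lambda>x. g x - g' x) \<le> \<delta>"
    if "0 < \<delta>" for \<delta>
  proof -
    \<comment> \<open>Near \<open>f\<close> every energy exceeds \<open>a - \<delta>/8\<close>. For
      \<open>g\<close>, \<open>g'\<close> of energy at most \<open>a + \<delta>/8\<close> with
      midpoint near \<open>f\<close>, the parallelogram identity bounds \<open>Q (g - g')\<close> by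
      \<open>4 * (a + \<delta>/8) - 4 * (a - \<delta>/8) = \<delta>\<close>.\<close>
    from not_H[of "\<delta> / 8"] that obtain U e where U: "U \<in> fmeasurable M" and e: "0 < e"
      and low: "\<And>g. g \<in> D \<Longrightarrow> local_dist M U g f < e \<Longrightarrow> a - \<delta> / 8 < Q g"
      unfolding H_def by (metis divide_pos_pos not_le zero_less_numeral)
    have "Q (\<lambda>x. g x - g' x) \<le> \<delta>"
      if g: "g \<in> A (U, min (e / 2) (\<delta> / 8))" and g': "g' \<in> A (U, min (e / 2) (\<delta> / 8))" for g g'
    proof -
      have D: "g \<in> D" "g' \<in> D" using g g' by (auto simp: A_def)
      have "local_dist M U (\<lambda>x. 1/2 * (g x + g' x)) f < e"
        using local_dist_midpoint[OF U D[THEN D_measurable] f] g g' by (auto simp: A_def)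
      then have "a - \<delta> / 8 < Q (\<lambda>x. 1/2 * (g x + g' x))"
        by (intro low D_intros D)
      also have "\<dots> = Q (\<lambda>x. g x + g' x) / 4"
        using Q_scale[OF D_add_diff(1)[OF D], of "1/2"] by (simp add: power2_eq_square)
      finally have "a - \<delta> / 8 < Q (\<lambda>x. g x + g' x) / 4" .
      moreover have "Q g \<le> a + \<delta> / 8" "Q g' \<le> a + \<delta> / 8"
        using g g' by (auto simp: A_def)
      ultimately show ?thesis using Q_parallelogram[OF D] by linarith
    qed
    moreover have "0 < min (e / 2) (\<delta> / 8)" using e that by simp
    ultimately show ?thesis using U by blast
  qed
  have "limitin (form_topology M E) (\<lambda>(f, g). (\<lambda>x. f x - g x)) (\<lambda>x. 0) (F \<times>\<^sub>F F)"
  proof (rule limitin_form_topologyI)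
    show "(\<lambda>x. 0) \<in> D" by (rule D_zero)
    show "\<forall>\<^sub>F i in F \<times>\<^sub>F F. (case i of (f, g) \<Rightarrow> \<lambda>x. f x - g x) \<in> D"
      using eventually_prodI[OF ev_D ev_D] by (rule eventually_mono) (auto intro: D_intros)
  next
    fix U assume U: "U \<in> fmeasurable M"
    show "((\<lambda>i. local_dist M U (case i of (f, g) \<Rightarrow> \<lambda>x. f x - g x) (\<lambda>x. 0)) \<longlongrightarrow> 0) (F \<times>\<^sub>F F)"
    proof (rule tendstoI)
      fix e :: real assume e: "0 < e"
      have ev: "\<forall>\<^sub>F g in F. g \<in> A (U, e / 2)" using ev_A U e by simp
      show "\<forall>\<^sub>F i in F \<times>\<^sub>F F.
          dist (local_dist M U (case i of (f, g) \<Rightarrow> \<lambda>x. f x - g x) (\<lambda>x. 0)) 0 < e"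
        using eventually_prodI[OF ev ev]
      proof (rule eventually_mono)
        fix i assume i: "fst i \<in> A (U, e / 2) \<and> snd i \<in> A (U, e / 2)"
        have "local_dist M U (fst i) (snd i) \<le> local_dist M U (fst i) f + local_dist M U f (snd i)"
          using i by (intro local_dist_triangle U f) (auto simp: A_def D_measurable)
        also have "\<dots> < e"
          using i by (simp add: A_def local_dist_commute[of M U f])
        finally show "dist (local_dist M U (case i of (f, g) \<Rightarrow> \<lambda>x. f x - g x) (\<lambda>x. 0)) 0 < e"
          by (simp add: case_prod_beta local_dist_diff_zero dist_real_def local_dist_nonneg)
      qed
    qed
  next
    show "((\<lambda>i. Q (\<lambda>x. (case i of (f, g) \<Rightarrow> \<lambda>x. f x - g x) x - 0)) \<longlongrightarrow> 0) (F \<times>\<^sub>F F)"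
    proof (rule tendstoI)
      fix \<delta> :: real assume "0 < \<delta>"
      then obtain U e where U: "U \<in> fmeasurable M" "0 < e"
        and Q: "\<forall>g\<in>A (U, e). \<forall>g'\<in>A (U, e). Q (\<lambda>x. g x - g' x) \<le> \<delta> / 2"
        using ev_Q[of "\<delta> / 2"] by auto
      have ev: "\<forall>\<^sub>F g in F. g \<in> A (U, e)" using ev_A U by simp
      show "\<forall>\<^sub>F i in F \<times>\<^sub>F F.
          dist (Q (\<lambda>x. (case i of (f, g) \<Rightarrow> \<lambda>x. f x - g x) x - 0)) 0 < \<delta>"
        using eventually_prodI[OF ev ev]
      proof (rule eventually_mono)
        fix i assume i: "fst i \<in> A (U, e) \<and> snd i \<in> A (U, e)"
        then have "Q (\<lambda>x. fst i x - snd i x) \<le> \<delta> / 2" using Q by blast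
        then show "dist (Q (\<lambda>x. (case i of (f, g) \<Rightarrow> \<lambda>x. f x - g x) x - 0)) 0 < \<delta>"
          using \<open>0 < \<delta>\<close> by (simp add: case_prod_beta dist_real_def)
      qed
    qed
  qed
  moreover have "F \<le> principal (topspace (form_topology M E))"
    using ev_D by (simp add: le_principal)
  ultimately obtain l where l: "limitin (form_topology M E) (\<lambda>f. f) l F"
    using closed F_bot unfolding closed_form_def complete_function_space_def by blast
  note l_lim = limitin_form_topologyD[OF l]
  have "local_dist M U l f = 0" if U: "U \<in> fmeasurable M" for U
  proof -
    have "local_dist M U l f \<le> e" if "0 < e" for e
    proof -
      have "\<forall>\<^sub>F g in F. local_dist M U g l < e / 2"
        using that by (intro order_tendstoD(2)[OF l_lim(3)[OF U]]) simp
      moreover have "\<forall>\<^sub>F g in F. g \<in> A (U, e / 2)"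
        using ev_A U that by simp
      ultimately have "\<forall>\<^sub>F g in F. local_dist M U g l < e / 2 \<and> g \<in> A (U, e / 2)"
        by (rule eventually_conj)
      then obtain g where g: "local_dist M U g l < e / 2" "g \<in> A (U, e / 2)"
        using F_bot eventually_happens by blast
      have "local_dist M U l f \<le> local_dist M U l g + local_dist M U g f"
        using g l_lim(1) by (intro local_dist_triangle U f) (auto simp: A_def D_measurable)
      also have "\<dots> \<le> e"
        using g by (simp add: A_def local_dist_commute[of M U l])
      finally show ?thesis .
    qed
    then have "local_dist M U l f \<le> 0"
      by (rule dense_ge)
    then show ?thesis
      using local_dist_nonneg[of M U l f] by simp
  qed
  then have "AE x in M. l x = f x"
    by (intro AE_eq_of_local_dist_zero semifinite f D_measurable l_lim(1))
  then have "E f = E l"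
    using E_AE_cong[of l f] f l_lim(1) D_measurable by simp
  moreover have "Q l \<le> a"
  proof -
    \<comment> \<open>Only the energy bound in \<open>A\<close> matters here, so the empty set is
      taken for \<open>U\<close>.\<close>
    have "sqrt (Q l) \<le> sqrt (a + e) + e" if e: "0 < e" for e
    proof -
      have "((\<lambda>g. sqrt (Q (\<lambda>x. g x - l x))) \<longlongrightarrow> 0) F"
        using tendsto_real_sqrt[OF l_lim(4)] by simp
      then have "\<forall>\<^sub>F g in F. sqrt (Q (\<lambda>x. g x - l x)) < e"
        using e by (rule order_tendstoD(2))
      then have "\<forall>\<^sub>F g in F. sqrt (Q (\<lambda>x. g x - l x)) < e \<and> g \<in> A ({}, e)"
        by (intro eventually_conj ev_A e) auto
      then obtain g where g: "sqrt (Q (\<lambda>x. g x - l x)) < e" "g \<in> A ({}, e)"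
        using F_bot eventually_happens by blast
      then have gD: "g \<in> D" and "Q g \<le> a + e" by (auto simp: A_def)
      have "sqrt (Q l) \<le> sqrt (Q g) + sqrt (Q (\<lambda>x. l x - g x))"
        using sqrt_Q_triangle[OF gD D_add_diff(2)[OF l_lim(1) gD]] by simp
      also have "\<dots> \<le> sqrt (a + e) + e"
        using g \<open>Q g \<le> a + e\<close> by (intro add_mono real_sqrt_le_mono)
          (simp_all add: Q_minus_commute[OF l_lim(1) gD])
      finally show ?thesis .
    qed
    then have "\<forall>\<^sub>F e in at_right 0. sqrt (Q l) \<le> sqrt (a + e) + e"
      by (auto simp: eventually_at_right_field intro: exI[of _ 1])
    moreover have "((\<lambda>e. sqrt (a + e) + e) \<longlongrightarrow> sqrt (a + 0) + 0) (at_right 0)"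
      by (intro tendsto_intros)
    ultimately have "sqrt (Q l) \<le> sqrt (a + 0) + 0"
      by (intro tendsto_lowerbound) auto
    then show ?thesis by simp
  qed
  then have "E l \<le> C"
    using a_c real ennreal_Q[OF l_lim(1)] by (metis ennreal_leI order_trans)
  ultimately show ?thesis by simp
qed

lemma E_le_of_limit:
  assumes f: "\<And>n. f n \<in> borel_measurable M" and lim: "\<And>x. (\<lambda>n. f n x) \<longlonglongrightarrow> g x"
    and le: "\<And>n. E (f n) \<le> C"
  shows "E g \<le> C"
proof (rule lower_semicontinuous)
  show g: "g \<in> borel_measurable M"
    by (rule borel_measurable_LIMSEQ_real[OF lim f])
  fix U and e :: real assume U: "U \<in> fmeasurable M" and e: "0 < e"
  have "(\<lambda>n. local_dist M U (f n) g) \<longlonglongrightarrow> 0"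
    by (rule local_dist_tendsto_zero[OF U f g]) (simp add: lim)
  from order_tendstoD(2)[OF this e] obtain n where "local_dist M U (f n) g < e"
    by (auto simp: eventually_sequentially)
  then show "\<exists>g'\<in>borel_measurable M. local_dist M U g' g < e \<and> E g' \<le> C"
    using f le by blast
qed

end

section \<open>Energy forms and normal contractions\<close>

lemma local_dist_le_of_uniform:
  assumes U: "U \<in> fmeasurable M" and f: "f \<in> borel_measurable M" and g: "g \<in> borel_measurable M"
    and le: "\<And>x. \<bar>f x - g x\<bar> \<le> e"
  shows "local_dist M U f g \<le> e * measure M U"
proof -
  have int: "integrable M (\<lambda>x. indicator U x *\<^sub>R e)"
    using U by (simp add: fmeasurable_def)
  have "local_dist M U f g \<le> (\<integral>x. indicator U x *\<^sub>R e \<partial>M)"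
    unfolding local_dist_def set_lebesgue_integral_def
    using local_dist_integrable[OF U f g] int le
    by (intro integral_mono) (auto simp: set_integrable_def min_le_iff_disj split: split_indicator)
  also have "\<dots> = e * measure M U"
    using U by (simp add: fmeasurableD)
  finally show ?thesis .
qed

text \<open>Below 0 monotonicity puts \<open>C x\<close> between \<open>-\<epsilon>\<close> and
  \<open>C 0 = 0\<close>, above 1 between \<open>C 1 = 1\<close> and \<open>1 + \<epsilon>\<close>.
  Hence all cutoffs tend uniformly to the same map as \<open>\<epsilon>\<close> decreases to
  0.\<close>

lemma cutoff_close_clamp:
  assumes "cutoff \<epsilon> C"
  shows "\<bar>C x - min (max x 0) 1\<bar> \<le> \<epsilon>"
proof -
  have mono: "mono C" and range: "C x \<in> {-\<epsilon>..1 + \<epsilon>}" and id: "\<And>x. x \<in> {0..1} \<Longrightarrow> C x = x"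
    using assms unfolding cutoff_def by blast+
  have "0 \<le> \<epsilon>"
    using assms id[of 0] rangeI[of C 0] by (auto simp: cutoff_def)
  consider "x < 0" | "x \<in> {0..1}" | "1 < x" by fastforce
  then show ?thesis
  proof cases
    case 1
    then show ?thesis using monoD[OF mono, of x 0] id[of 0] range by simp
  next
    case 2
    then show ?thesis using id \<open>0 \<le> \<epsilon>\<close> by simp
  next
    case 3
    then show ?thesis using monoD[OF mono, of 1 x] id[of 1] range by simp
  qed
qed

lemma min_of_nat_tendsto: "(\<lambda>n. min (real n) a) \<longlonglongrightarrow> a"
proof (rule tendsto_eventually)
  obtain k :: nat where "a \<le> real k" using real_arch_simple by blast
  then show "\<forall>\<^sub>F n in sequentially. min (real n) a = a"
    by (auto simp: eventually_sequentially min_def intro!: exI[of _ k])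
qed

locale energy_form_on = closed_local_form +
  assumes markov: "Markovian M E"
begin

lemma E_clamp_le:
  assumes f: "f \<in> borel_measurable M"
  shows "E (\<lambda>x. min (max (f x) 0) 1) \<le> E f"
proof (rule lower_semicontinuous)
  have [measurable]: "f \<in> borel_measurable M" by (rule f)
  show clamp: "(\<lambda>x. min (max (f x) 0) 1) \<in> borel_measurable M" by measurable
  fix U and e :: real assume U: "U \<in> fmeasurable M" and e: "0 < e"
  \<comment> \<open>The summand 1 covers sets \<open>U\<close> of measure zero and makes the final
    bound strict.\<close>
  define \<epsilon> where "\<epsilon> = e / (1 + measure M U)"
  have "0 < \<epsilon>" using e by (simp add: \<epsilon>_def add_pos_nonneg)
  then obtain C where C: "cutoff \<epsilon> C" and le: "E (C \<circ> f) \<le> E f"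
    using markov f unfolding Markovian_def by blast
  have "mono C" using C by (simp add: cutoff_def)
  then have Cf: "C \<circ> f \<in> borel_measurable M"
    using borel_measurable_mono[of C] f by (metis measurable_comp)
  have "local_dist M U (C \<circ> f) (\<lambda>x. min (max (f x) 0) 1) \<le> \<epsilon> * measure M U"
    by (rule local_dist_le_of_uniform[OF U Cf clamp]) (simp add: cutoff_close_clamp[OF C])
  also have "\<dots> < \<epsilon> * (1 + measure M U)"
    using \<open>0 < \<epsilon>\<close> by simp
  also have "\<dots> = e"
    by (simp add: \<epsilon>_def add_nonneg_eq_0_iff)
  finally show "\<exists>g\<in>borel_measurable M.
      local_dist M U g (\<lambda>x. min (max (f x) 0) 1) < e \<and> E g \<le> E f"
    using Cf le by blast
qed

text \<open>Homogeneity transfers the unit clamp of \<open>f / c\<close> to the clamp of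
  \<open>f\<close> at height \<open>c\<close>; \<open>Suc n\<close> keeps \<open>c\<close>
  positive.\<close>

lemma E_clamp_nat_le:
  assumes f: "f \<in> borel_measurable M"
  shows "E (\<lambda>x. min (real (Suc n)) (max (f x) 0)) \<le> E f"
proof -
  define c where "c = real (Suc n)"
  have c: "0 < c" by (simp add: c_def)
  have [measurable]: "f \<in> borel_measurable M" by (rule f)
  define g where "g x = 1 / c * f x" for x
  have [measurable]: "g \<in> borel_measurable M" unfolding g_def[abs_def] by measurable
  have "(\<lambda>x. min c (max (f x) 0)) = (\<lambda>x. c * min (max (g x) 0) 1)"
    using c by (auto simp: g_def fun_eq_iff min_def max_def field_simps)
  then have "E (\<lambda>x. min c (max (f x) 0)) = ennreal (c\<^sup>2) * E (\<lambda>x. min (max (g x) 0) 1)"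
    by (simp add: E_scale)
  also have "\<dots> \<le> ennreal (c\<^sup>2) * E g"
    by (intro mult_left_mono E_clamp_le) auto
  also have "\<dots> = E (\<lambda>x. c * g x)"
    by (simp add: E_scale)
  also have "(\<lambda>x. c * g x) = f"
    using c by (simp add: g_def)
  finally show ?thesis by (simp add: c_def)
qed

lemma E_pos_le:
  assumes f: "f \<in> borel_measurable M"
  shows "E (\<lambda>x. max (f x) 0) \<le> E f"
proof (rule E_le_of_limit[where f = "\<lambda>n x. min (real (Suc n)) (max (f x) 0)"])
  show "(\<lambda>x. min (real (Suc n)) (max (f x) 0)) \<in> borel_measurable M" for n
    using f by measurable
  show "(\<lambda>n. min (real (Suc n)) (max (f x) 0)) \<longlonglongrightarrow> max (f x) 0" for x
    using LIMSEQ_Suc[OF min_of_nat_tendsto] .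
qed (rule E_clamp_nat_le[OF f])

lemma D_pos: "f \<in> D \<Longrightarrow> (\<lambda>x. max (f x) 0) \<in> D"
  using E_pos_le[of f] by (auto simp: form_domain_def intro: le_less_trans)

lemma D_abs: "f \<in> D \<Longrightarrow> (\<lambda>x. \<bar>f x\<bar>) \<in> D"
proof -
  assume f: "f \<in> D"
  have "(\<lambda>x. \<bar>f x\<bar>) = (\<lambda>x. max (f x) 0 + max (- f x) 0)" by auto
  then show ?thesis using D_add_diff(1)[OF D_pos[OF f] D_pos[OF D_minus[OF f]]] by simp
qed

lemma D_max:
  assumes "f \<in> D" "g \<in> D"
  shows "(\<lambda>x. max (f x) (g x)) \<in> D"
proof -
  have "(\<lambda>x. max (f x) (g x)) = (\<lambda>x. g x + max (f x - g x) 0)" by auto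
  then show ?thesis
    using D_add_diff(1)[OF assms(2) D_pos[OF D_add_diff(2)[OF assms]]] by simp
qed

lemma D_min:
  assumes "f \<in> D" "g \<in> D"
  shows "(\<lambda>x. min (f x) (g x)) \<in> D"
proof -
  have "(\<lambda>x. min (f x) (g x)) = (\<lambda>x. - max (- f x) (- g x))" by auto
  then show ?thesis
    using D_minus[OF D_max[OF D_minus D_minus, OF assms]] by simp
qed

text \<open>Since \<open>f\<^sup>+ - t f\<^sup>-\<close> has positive part \<open>f\<^sup>+\<close>, its energy is minimal over \<open>t \<ge> 0\<close> at \<open>t = 0\<close>.\<close>
lemma B_pos_neg_nonpos:
  assumes f: "f \<in> D"
  shows "B (\<lambda>x. max (f x) 0) (\<lambda>x. max (- f x) 0) \<le> 0"
proof (rule ccontr)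
  let ?p = "\<lambda>x. max (f x) 0" and ?n = "\<lambda>x. max (- f x) 0"
  assume "\<not> B ?p ?n \<le> 0"
  then have b: "0 < B ?p ?n" by simp
  have p: "?p \<in> D" and n: "?n \<in> D" using f by (auto intro: D_pos D_minus)
  have *: "2 * t * B ?p ?n \<le> t\<^sup>2 * Q ?n" if "0 < t" for t
  proof -
    have g: "(\<lambda>x. ?p x + (- t) * ?n x) \<in> D" by (intro D_intros p n)
    have "(\<lambda>x. max (?p x + (- t) * ?n x) 0) = ?p"
      using that by (auto simp: fun_eq_iff max_def mult_nonneg_nonpos mult_le_0_iff)
    then have "Q ?p \<le> Q (\<lambda>x. ?p x + (- t) * ?n x)"
      using Q_mono[OF g E_pos_le[OF D_measurable[OF g]]] by simp
    then show ?thesis using Q_add_scale[OF p n, of "- t"] by simp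
  qed
  \<comment> \<open>So small that the quadratic term cannot compensate the linear one; the summand 1
    avoids division by zero.\<close>
  define t where "t = B ?p ?n / (Q ?n + 1)"
  have Qn: "0 < Q ?n + 1" by (simp add: add_nonneg_pos)
  then have t: "0 < t" using b by (simp add: t_def)
  with *[OF t] have "2 * B ?p ?n \<le> t * Q ?n"
    by (simp add: power2_eq_square)
  also have "\<dots> \<le> t * (Q ?n + 1)" using t by simp
  also have "\<dots> = B ?p ?n" using Qn by (simp add: t_def)
  finally show False using b by simp
qed

text \<open>Expanding the sum and the difference of positive and negative part, the two energies
  differ by four times the nonpositive mixed term.\<close>

lemma Q_abs_le:
  assumes f: "f \<in> D"
  shows "Q (\<lambda>x. \<bar>f x\<bar>) \<le> Q f"
proof -
  let ?p = "\<lambda>x. max (f x) 0" and ?n = "\<lambda>x. max (- f x) 0"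
  have p: "?p \<in> D" and n: "?n \<in> D" using f by (auto intro: D_pos D_minus)
  have "(\<lambda>x. \<bar>f x\<bar>) = (\<lambda>x. ?p x + 1 * ?n x)" "f = (\<lambda>x. ?p x + (-1) * ?n x)" by auto
  then have "Q (\<lambda>x. \<bar>f x\<bar>) = Q ?p + 2 * B ?p ?n + Q ?n" "Q f = Q ?p - 2 * B ?p ?n + Q ?n"
    using Q_add_scale[OF p n, of 1] Q_add_scale[OF p n, of "-1"] by simp_all
  then show ?thesis using B_pos_neg_nonpos[OF f] by simp
qed

text \<open>Maximum and minimum have sum \<open>f + g\<close> and difference
  \<open>\<bar>f - g\<bar>\<close>, so two parallelogram identities reduce the claim to
  \<open>Q_abs_le\<close>.\<close>

lemma Q_min_max_le:
  assumes f: "f \<in> D" and g: "g \<in> D"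
  shows "Q (\<lambda>x. min (f x) (g x)) + Q (\<lambda>x. max (f x) (g x)) \<le> Q f + Q g"
proof -
  let ?m = "\<lambda>x. min (f x) (g x)" and ?M = "\<lambda>x. max (f x) (g x)"
  have D: "?m \<in> D" "?M \<in> D" by (intro D_min D_max f g)+
  have "(\<lambda>x. ?M x + ?m x) = (\<lambda>x. f x + g x)" "(\<lambda>x. ?M x - ?m x) = (\<lambda>x. \<bar>f x - g x\<bar>)" by auto
  then have "2 * Q ?M + 2 * Q ?m = Q (\<lambda>x. f x + g x) + Q (\<lambda>x. \<bar>f x - g x\<bar>)"
    using Q_parallelogram[OF D(2,1)] by simp
  also have "\<dots> \<le> 2 * Q f + 2 * Q g"
    using Q_parallelogram[OF f g] Q_abs_le[OF D_add_diff(2)[OF f g]] by simp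
  finally show ?thesis by simp
qed

section \<open>Superharmonic functions\<close>

text \<open>With \<open>p\<close>, \<open>n\<close> the positive and negative part of
  \<open>f - u\<close>, the minimum \<open>m\<close> satisfies \<open>f = m + p\<close> and
  \<open>m = u - n\<close>. Hence \<open>B m p = B u p - B n p\<close> is nonnegative, by
  superharmonicity and the sign of the mixed term.\<close>

lemma superharmonic_min_le:
  assumes u: "superharmonic M E u" and f: "f \<in> D"
  shows "E (\<lambda>x. min (f x) (u x)) \<le> E f"
proof -
  have uD: "u \<in> D" using u by (simp add: superharmonic_def)
  let ?w = "\<lambda>x. f x - u x"
  let ?p = "\<lambda>x. max (?w x) 0" and ?n = "\<lambda>x. max (- ?w x) 0" and ?m = "\<lambda>x. min (f x) (u x)"
  have w: "?w \<in> D" by (intro D_intros f uD)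
  have p: "?p \<in> D" and n: "?n \<in> D" by (intro D_pos D_minus w)+
  have m: "?m \<in> D" by (intro D_min f uD)
  have "?m = (\<lambda>x. u x - ?n x)" by auto
  then have "B ?m ?p = B u ?p - B ?n ?p"
    using B_diff_left[OF uD n p] by simp
  moreover have "0 \<le> B u ?p"
    using u p by (simp add: superharmonic_def)
  moreover have "B ?n ?p \<le> 0"
    using B_pos_neg_nonpos[OF w] B_commute[OF p n] by simp
  moreover have "f = (\<lambda>x. ?m x + ?p x)" by auto
  then have "Q f = Q ?m + 2 * B ?m ?p + Q ?p"
    using Q_add[OF m p] by simp
  moreover have "0 \<le> Q ?p" by (rule enn2real_nonneg)
  ultimately have "Q ?m \<le> Q f" by linarith
  then show ?thesis by (simp add: E_le_iff m f)
qed

text \<open>First variation: the energy of \<open>u + t * \<phi>\<close> is compared with that of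
  \<open>u\<close> as \<open>t\<close> decreases to 0.\<close>

lemma superharmonicI_minimal:
  assumes u: "u \<in> D"
    and min: "\<And>\<psi>. \<psi> \<in> D \<Longrightarrow> (\<And>x. 0 \<le> \<psi> x) \<Longrightarrow> Q u \<le> Q (\<lambda>x. u x + \<psi> x)"
  shows "superharmonic M E u"
  unfolding superharmonic_def
proof (intro conjI u ballI impI)
  fix \<psi> assume \<psi>: "\<psi> \<in> D" "AE x in M. 0 \<le> \<psi> x"
  \<comment> \<open>Test functions are nonnegative only almost everywhere, while \<open>min\<close>
    asks for pointwise nonnegativity.\<close>
  define \<phi> where "\<phi> x = max (\<psi> x) 0" for x
  have \<phi>: "\<phi> \<in> D" unfolding \<phi>_def by (intro D_pos \<psi>)
  have eq: "AE x in M. \<psi> x = \<phi> x" using \<psi>(2) by eventually_elim (simp add: \<phi>_def)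
  have "E (\<lambda>x. u x + \<psi> x) = E (\<lambda>x. u x + \<phi> x)" "E (\<lambda>x. u x - \<psi> x) = E (\<lambda>x. u x - \<phi> x)"
    by (intro E_AE_cong D_measurable D_intros u \<phi> \<psi>(1); use eq in eventually_elim; simp)+
  then have B: "B u \<psi> = B u \<phi>" by (simp add: form_bilinear_def)
  have "0 \<le> 2 * B u \<phi> + t * Q \<phi>" if "0 < t" for t
  proof -
    have "Q u \<le> Q (\<lambda>x. u x + t * \<phi> x)"
      using that by (intro min D_intros \<phi>) (simp add: \<phi>_def)
    then have "0 \<le> t * (2 * B u \<phi> + t * Q \<phi>)"
      by (simp add: Q_add_scale u \<phi> power2_eq_square algebra_simps)
    then show ?thesis using that by (simp add: zero_le_mult_iff)
  qed
  then have "\<forall>\<^sub>F t in at_right 0. 0 \<le> 2 * B u \<phi> + t * Q \<phi>"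
    by (auto simp: eventually_at_right_field intro: exI[of _ 1])
  moreover have "((\<lambda>t. 2 * B u \<phi> + t * Q \<phi>) \<longlongrightarrow> 2 * B u \<phi> + 0 * Q \<phi>) (at_right 0)"
    by (intro tendsto_intros)
  ultimately have "0 \<le> 2 * B u \<phi> + 0 * Q \<phi>"
    by (intro tendsto_lowerbound) auto
  then show "0 \<le> B u \<psi>" by (simp add: B)
qed

lemma superharmonic_measurable: "{u. superharmonic M E u} \<subseteq> borel_measurable M"
  by (auto simp: superharmonic_def D_measurable)

lemma excessive_min_le:
  assumes h: "h \<in> borel_measurable M" and exc: "excessive M E h" and f: "f \<in> D"
  shows "E (\<lambda>x. min (f x) (h x)) \<le> E f"
proof (rule lower_semicontinuous)
  have [measurable]: "h \<in> borel_measurable M" "f \<in> borel_measurable M"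
    using h f by (auto simp: D_measurable)
  show fh: "(\<lambda>x. min (f x) (h x)) \<in> borel_measurable M" by measurable
  fix U and e :: real assume U: "U \<in> fmeasurable M" and e: "0 < e"
  then obtain u where u: "superharmonic M E u" and dist: "local_dist M U u h < e"
    using exc unfolding excessive_def in_closure_local_measure_iff[OF h superharmonic_measurable]
    by blast
  have [measurable]: "u \<in> borel_measurable M" using u superharmonic_measurable by blast
  have "local_dist M U (\<lambda>x. min (f x) (u x)) (\<lambda>x. min (f x) (h x)) \<le> local_dist M U u h"
    by (rule local_dist_mono[OF U]) (measurable; auto)+
  then show "\<exists>g\<in>borel_measurable M.
      local_dist M U g (\<lambda>x. min (f x) (h x)) < e \<and> E g \<le> E f"
    using dist superharmonic_min_le[OF u f] by (intro bexI[of _ "\<lambda>x. min (f x) (u x)"]) auto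
qed

text \<open>
  A minimising sequence need not converge when the form has a large kernel. Instead the
  inequality E (min f g) + E (max f g) \<le> E f + E g shows that infima of tails of a fast minimising
  sequence still nearly minimise; these infima increase and stay below \<open>h\<close>.
\<close>
lemma order_interval_minimizer:
  assumes p: "p \<in> D" and ph: "\<And>x. p x \<le> h x"
  obtains u where "u \<in> D" "\<And>x. p x \<le> u x" "\<And>x. u x \<le> h x"
    "\<And>g. g \<in> D \<Longrightarrow> (\<And>x. p x \<le> g x) \<Longrightarrow> (\<And>x. g x \<le> h x) \<Longrightarrow> Q u \<le> Q g"
proof -
  define K where "K = {g \<in> D. \<forall>x. p x \<le> g x \<and> g x \<le> h x}"
  have pK: "p \<in> K" using p ph by (simp add: K_def)
  define a where "a = Inf (Q ` K)"
  have bdd: "bdd_below (Q ` K)" by (auto intro: bdd_belowI[of _ 0])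
  have a_le: "a \<le> Q g" if "g \<in> K" for g
    unfolding a_def using that bdd by (intro cInf_lower) auto
  have a_nonneg: "0 \<le> a"
    unfolding a_def using pK by (intro cInf_greatest) auto
  have "\<exists>g\<in>K. Q g < a + (1/2) ^ n" for n
  proof -
    have "Inf (Q ` K) < a + (1/2) ^ n" "Q ` K \<noteq> {}" using pK by (auto simp: a_def)
    from cInf_lessD[OF this(2,1)] show ?thesis by blast
  qed
  then obtain g where g: "g n \<in> K" and Qg: "Q (g n) < a + (1/2) ^ n" for n
    by metis
  \<comment> \<open>\<open>w n m\<close> is the minimum of \<open>g n\<close>, ...,
    \<open>g (n + m)\<close>.\<close>
  define w where "w n = rec_nat (g n) (\<lambda>m v x. min (v x) (g (n + Suc m) x))" for n
  have w_0: "w n 0 = g n" and w_Suc: "w n (Suc m) = (\<lambda>x. min (w n m x) (g (n + Suc m) x))" for n m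
    by (simp_all add: w_def)
  have w_K: "w n m \<in> K" for n m
    by (induction m) (use g in \<open>auto simp: w_0 w_Suc K_def min_le_iff_disj intro: D_min\<close>)
  \<comment> \<open>The excess over \<open>a\<close> is the geometric sum of
    \<open>(1/2) ^ k\<close> for \<open>k\<close> from \<open>n\<close> to \<open>n + m\<close>.
    Each further minimum adds at most the excess of the new \<open>g k\<close>, because the
    discarded maximum stays in \<open>K\<close> and so has energy at least \<open>a\<close>.\<close>
  have Qw: "Q (w n m) \<le> a + 2 * (1/2) ^ n - (1/2) ^ (n + m)" for n m
  proof (induction m)
    case 0
    then show ?case using Qg[of n] by (simp add: w_0)
  next
    case (Suc m)
    have D: "w n m \<in> D" "g (n + Suc m) \<in> D" using w_K g by (auto simp: K_def)
    have "(\<lambda>x. max (w n m x) (g (n + Suc m) x)) \<in> K"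
      using w_K[of n m] g[of "n + Suc m"] by (auto simp: K_def le_max_iff_disj intro: D_max)
    with Q_min_max_le[OF D] a_le have "Q (w n (Suc m)) + a \<le> Q (w n m) + Q (g (n + Suc m))"
      unfolding w_Suc by fastforce
    with Suc.IH Qg[of "n + Suc m"] show ?case by simp
  qed
  define G where "G n x = lim (\<lambda>m. w n m x)" for n x
  have w_G: "(\<lambda>m. w n m x) \<longlonglongrightarrow> G n x" for n x
  proof -
    have "decseq (\<lambda>m. w n m x)" by (auto intro: decseq_SucI simp: w_Suc)
    moreover have "p x \<le> w n m x" for m using w_K by (simp add: K_def)
    ultimately have "convergent (\<lambda>m. w n m x)"
      by (metis decseq_convergent convergentI)
    then show ?thesis by (simp add: G_def convergent_LIMSEQ_iff)
  qed
  have G_bounds: "p x \<le> G n x" "G n x \<le> h x" for n x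
    using w_K[of n] by (auto intro!: LIMSEQ_le_const[OF w_G] LIMSEQ_le_const2[OF w_G] simp: K_def)
  have G_measurable: "G n \<in> borel_measurable M" for n
    using w_K[of n] by (intro borel_measurable_LIMSEQ_real[OF w_G]) (auto simp: K_def D_measurable)
  have E_G: "E (G n) \<le> ennreal (a + 2 * (1/2) ^ n)" for n
  proof (rule E_le_of_limit[OF _ w_G])
    fix m
    show "w n m \<in> borel_measurable M" using w_K[of n m] by (auto simp: K_def D_measurable)
    have "Q (w n m) \<le> a + 2 * (1/2) ^ n"
      using Qw[of n m] zero_le_power[of "1/2 :: real" "n + m"] by linarith
    then show "E (w n m) \<le> ennreal (a + 2 * (1/2) ^ n)"
      using w_K[of n m] ennreal_Q[of "w n m"] by (metis (no_types, lifting) K_def ennreal_leI mem_Collect_eq)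
  qed
  \<comment> \<open>Both minima end at index \<open>n + m + 1\<close>; the left one also includes
    \<open>g n\<close>.\<close>
  have "w n (Suc m) x \<le> w (Suc n) m x" for n m x
    by (induction m) (auto simp: w_0 w_Suc min_le_iff_disj)
  then have "G n x \<le> G (Suc n) x" for n x
    by (intro LIMSEQ_le[OF LIMSEQ_Suc[OF w_G] w_G]) auto
  then have G_inc: "incseq (\<lambda>n. G n x)" for x by (rule incseq_SucI)
  define u where "u x = lim (\<lambda>n. G n x)" for x
  have G_u: "(\<lambda>n. G n x) \<longlonglongrightarrow> u x" for x
    using incseq_convergent[OF G_inc[of x], of "h x"] G_bounds(2)
    by (metis convergent_LIMSEQ_iff convergentI u_def)
  have u_bounds: "p x \<le> u x" "u x \<le> h x" for x
    using G_bounds by (auto intro!: LIMSEQ_le_const[OF G_u] LIMSEQ_le_const2[OF G_u])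
  have u_measurable: "u \<in> borel_measurable M"
    by (rule borel_measurable_LIMSEQ_real[OF G_u G_measurable])
  have E_u: "E u \<le> ennreal (a + 2 * (1/2) ^ k)" for k
  proof (rule E_le_of_limit[OF G_measurable])
    show "(\<lambda>n. G (n + k) x) \<longlonglongrightarrow> u x" for x
      by (rule LIMSEQ_ignore_initial_segment[OF G_u])
    fix n
    have "a + 2 * (1/2) ^ (n + k) \<le> a + 2 * (1/2) ^ k"
      by (simp add: power_decreasing)
    then show "E (G (n + k)) \<le> ennreal (a + 2 * (1/2) ^ k)"
      using E_G[of "n + k"] by (metis ennreal_leI order_trans)
  qed
  have uD: "u \<in> D" using u_measurable E_u by (rule domainI_le)
  have "(\<lambda>k. a + 2 * (1/2) ^ k) \<longlonglongrightarrow> a + 2 * 0"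
    by (intro tendsto_intros) simp
  then have "Q u \<le> a + 2 * 0"
    by (rule LIMSEQ_le_const) (use E_u a_nonneg in \<open>auto intro!: Q_le\<close>)
  then show thesis
    using uD u_bounds a_le by (intro that[of u]) (fastforce simp: K_def)+
qed

text \<open>The hypothesis \<open>le\<close> acts twice: it puts the lower end of the order interval
  into \<open>D\<close>, and it bounds the energy of \<open>u + \<psi>\<close> truncated at
  \<open>h\<close>, a competitor of the minimiser \<open>u\<close>, by that of
  \<open>u + \<psi>\<close>.\<close>

lemma superharmonic_between:
  assumes le: "\<And>f. f \<in> D \<Longrightarrow> E (\<lambda>x. min (f x) (h x)) \<le> E f"
    and h: "h \<in> borel_measurable M" and f: "f \<in> D"
  obtains u where "superharmonic M E u" "\<And>x. min (f x) (h x) \<le> u x" "\<And>x. u x \<le> h x"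
proof -
  have min_D: "(\<lambda>x. min (v x) (h x)) \<in> D" if v: "v \<in> D" for v
  proof -
    have "(\<lambda>x. min (v x) (h x)) \<in> borel_measurable M"
      using D_measurable[OF v] h by measurable
    then show ?thesis
      using le[OF v] v by (auto simp: form_domain_def intro: le_less_trans)
  qed
  obtain u where u: "u \<in> D" "\<And>x. min (f x) (h x) \<le> u x" "\<And>x. u x \<le> h x"
    and minimal: "\<And>g. g \<in> D \<Longrightarrow> (\<And>x. min (f x) (h x) \<le> g x) \<Longrightarrow> (\<And>x. g x \<le> h x) \<Longrightarrow> Q u \<le> Q g"
    using order_interval_minimizer[OF min_D[OF f], of h] by auto
  have "superharmonic M E u"
  proof (rule superharmonicI_minimal[OF u(1)])
    fix \<psi> assume \<psi>: "\<psi> \<in> D" "\<And>x. 0 \<le> \<psi> x"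
    have v: "(\<lambda>x. u x + \<psi> x) \<in> D" by (intro D_intros u \<psi>)
    have "Q u \<le> Q (\<lambda>x. min (u x + \<psi> x) (h x))"
    proof (rule minimal[OF min_D[OF v]])
      show "min (f x) (h x) \<le> min (u x + \<psi> x) (h x)" for x
        using u(2)[of x] \<psi>(2)[of x] by simp
    qed simp
    also have "\<dots> \<le> Q (\<lambda>x. u x + \<psi> x)"
      by (rule Q_mono[OF v le[OF v]])
    finally show "Q u \<le> Q (\<lambda>x. u x + \<psi> x)" .
  qed
  then show thesis using u that by blast
qed

text \<open>Exhaustion: the functions \<open>f n\<close> nearly maximise the measure of \<open>{x \<in> U. 0 < f n x}\<close>.\<close>
lemma full_support_exhaustion:
  assumes supp: "full_support M E" and U: "U \<in> fmeasurable M"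
  obtains f :: "nat \<Rightarrow> 'a \<Rightarrow> real" where "\<And>n. f n \<in> D" "\<And>x. incseq (\<lambda>n. f n x)"
    "AE x in M. x \<in> U \<longrightarrow> (\<exists>n. 0 < f n x)"
proof -
  define P where "P v = {x \<in> U. 0 < v x}" for v :: "'a \<Rightarrow> real"
  have P_eq: "P v = U \<inter> {x \<in> space M. 0 < v x}" for v
    using sets.sets_into_space[OF fmeasurableD[OF U]] by (auto simp: P_def)
  have P_fm: "P v \<in> fmeasurable M" if "v \<in> D" for v
    unfolding P_eq using D_measurable[OF that] by (intro fmeasurable_Int_fmeasurable U) measurable
  have P_le: "measure M (P v) \<le> measure M U" if "v \<in> D" for v
    using P_fm[OF that] U by (intro measure_mono_fmeasurable) (auto simp: P_def)
  define s where "s = Sup ((\<lambda>v. measure M (P v)) ` D)"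
  have s_upper: "measure M (P v) \<le> s" if "v \<in> D" for v
    unfolding s_def using that P_le by (intro cSup_upper) (auto intro!: bdd_aboveI2)
  have "\<exists>v\<in>D. s - 1 / real (Suc n) < measure M (P v)" for n
  proof -
    have "s - 1 / real (Suc n) < s" by simp
    then show ?thesis
      unfolding s_def using less_cSupD[of "(\<lambda>v. measure M (P v)) ` D"] D_zero by fastforce
  qed
  then obtain e where e: "e n \<in> D" and Pe: "s - 1 / real (Suc n) < measure M (P (e n))" for n
    by metis
  \<comment> \<open>Running maxima are monotone and only enlarge the positivity sets.\<close>
  define f where "f = rec_nat (\<lambda>x. max (e 0 x) 0) (\<lambda>n v x. max (v x) (e (Suc n) x))"
  have f_0: "f 0 = (\<lambda>x. max (e 0 x) 0)" and f_Suc: "f (Suc n) = (\<lambda>x. max (f n x) (e (Suc n) x))" for n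
    by (simp_all add: f_def)
  have f_D: "f n \<in> D" for n
    by (induction n) (auto simp: f_0 f_Suc intro: D_max D_pos e)
  have f_inc: "incseq (\<lambda>n. f n x)" for x
    by (rule incseq_SucI) (simp add: f_Suc)
  have Pf: "s - 1 / real (Suc n) < measure M (P (f n))" for n
  proof -
    have "e n x \<le> f n x" for x by (cases n) (auto simp: f_0 f_Suc)
    then have "P (e n) \<subseteq> P (f n)" by (fastforce simp: P_def intro: less_le_trans)
    then have "measure M (P (e n)) \<le> measure M (P (f n))"
      by (intro measure_mono_fmeasurable P_fm f_D fmeasurableD e)
    with Pe[of n] show ?thesis by linarith
  qed
  have [measurable]: "f n \<in> borel_measurable M" for n using f_D D_measurable by blast
  have [measurable]: "U \<in> sets M" using U by auto
  define G where "G = {x \<in> space M. \<exists>n. 0 < f n x}"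
  have [measurable]: "G \<in> sets M" unfolding G_def by measurable
  \<comment> \<open>Otherwise, for large \<open>n\<close>, the maximum of \<open>f n\<close> and
    \<open>v\<close> would have a positivity set in \<open>U\<close> of measure above the supremum
    \<open>s\<close>.\<close>
  have rest: "emeasure M (P v - G) = 0" if v: "v \<in> D" for v
  proof -
    have fm: "P v - G \<in> fmeasurable M"
      using P_fm[OF v] by (intro fmeasurable_Diff) auto
    have small: "measure M (P v - G) \<le> 1 / real (Suc n)" for n
    proof -
      have max_D: "(\<lambda>x. max (f n x) (v x)) \<in> D" by (intro D_max f_D v)
      have "measure M (P (f n)) + measure M (P v - G) = measure M (P (f n) \<union> (P v - G))"
        using P_fm[OF f_D, of n] fm sets.sets_into_space[OF \<open>U \<in> sets M\<close>]
        by (intro measure_Union[symmetric]) (auto simp: P_def G_def fmeasurable_def)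
      also have "\<dots> \<le> measure M (P (\<lambda>x. max (f n x) (v x)))"
        using P_fm[OF f_D, of n] fm
        by (intro measure_mono_fmeasurable P_fm max_D) (auto simp: P_def)
      also have "\<dots> \<le> s" by (rule s_upper[OF max_D])
      finally show ?thesis using Pf[of n] by linarith
    qed
    have "measure M (P v - G) \<le> 0"
      by (rule LIMSEQ_le_const[OF LIMSEQ_Suc[OF lim_1_over_n]]) (use small in auto)
    then have "measure M (P v - G) = 0" using measure_nonneg[of M "P v - G"] by linarith
    then show ?thesis using fm by (simp add: emeasure_eq_measure2)
  qed
  \<comment> \<open>The minimality clause of the essential supremum is applied to \<open>G\<close>
    together with the complement of \<open>U\<close>. Level sets involve
    \<open>\<bar>v x\<bar>\<close>, so \<open>rest\<close> is used for the absolute value, which is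
    in \<open>D\<close> by \<open>D_abs\<close>.\<close>
  have "emeasure M (space M - (G \<union> (space M - U))) = 0"
  proof -
    have "emeasure M ({x \<in> space M. \<bar>v x\<bar> \<ge> \<alpha>} - (G \<union> (space M - U))) = 0"
      if v: "v \<in> D" and "0 < \<alpha>" for v \<alpha>
    proof -
      have "{x \<in> space M. \<bar>v x\<bar> \<ge> \<alpha>} - (G \<union> (space M - U)) \<subseteq> P (\<lambda>x. \<bar>v x\<bar>) - G"
        using \<open>0 < \<alpha>\<close> by (auto simp: P_def)
      moreover have "P (\<lambda>x. \<bar>v x\<bar>) - G \<in> sets M"
        using P_fm[OF D_abs[OF v]] by auto
      ultimately show ?thesis
        using rest[OF D_abs[OF v]] emeasure_eq_0 by blast
    qed
    moreover have "G \<union> (space M - U) \<in> sets M" by measurable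
    ultimately show ?thesis
      using supp unfolding full_support_def ess_supremum_def by blast
  qed
  then have "AE x in M. x \<notin> space M - (G \<union> (space M - U))"
    by (intro AE_not_in null_setsI) measurable
  then have "AE x in M. x \<in> U \<longrightarrow> (\<exists>n. 0 < f n x)"
    by (rule AE_mp) (auto simp: G_def)
  with f_D f_inc show thesis by (rule that)
qed

lemma excessiveI:
  assumes supp: "full_support M E" and h: "h \<in> borel_measurable M"
    and le: "\<And>f. f \<in> D \<Longrightarrow> E (\<lambda>x. min (f x) (h x)) \<le> E f"
  shows "excessive M E h"
  unfolding excessive_def in_closure_local_measure_iff[OF h superharmonic_measurable]
proof (intro ballI allI impI)
  fix U and r :: real assume U: "U \<in> fmeasurable M" and r: "0 < r"
  obtain f where f: "\<And>n. f n \<in> D" and inc: "\<And>x. incseq (\<lambda>n. f n x)"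
    and pos: "AE x in M. x \<in> U \<longrightarrow> (\<exists>n::nat. 0 < f n x)"
    using full_support_exhaustion[OF supp U] by metis
  have "\<exists>u. superharmonic M E u \<and> (\<forall>x. min (real n * f n x) (h x) \<le> u x \<and> u x \<le> h x)" for n
    using superharmonic_between[OF le h D_scale[OF f], of "real n" n] by metis
  then obtain u where u: "\<And>n. superharmonic M E (u n)"
    and lower: "\<And>n x. min (real n * f n x) (h x) \<le> u n x" and upper: "\<And>n x. u n x \<le> h x"
    by metis
  have "(\<lambda>n. local_dist M U (u n) h) \<longlonglongrightarrow> 0"
  proof (rule local_dist_tendsto_zero[OF U _ h])
    show "u n \<in> borel_measurable M" for n using u superharmonic_measurable by blast
    show "AE x in M. x \<in> U \<longrightarrow> (\<lambda>n. u n x) \<longlonglongrightarrow> h x"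
      using pos
    proof (rule AE_mp, intro AE_I2 impI)
      fix x assume *: "x \<in> U \<longrightarrow> (\<exists>n. 0 < f n x)" "x \<in> U"
      then obtain k where k: "0 < f k x" by blast
      obtain j :: nat where j: "h x < real j * f k x" using reals_Archimedean3[OF k] by blast
      have "u n x = h x" if "max j k \<le> n" for n
      proof -
        \<comment> \<open>From this index on the lower bound for \<open>u n x\<close> is
          \<open>h x\<close> itself, so the sequence is eventually constant at
          \<open>x\<close>.\<close>
        have "real j * f k x \<le> real n * f n x"
          using that k incseqD[OF inc, of k n x] by (intro mult_mono) auto
        then show ?thesis using lower[of n x] upper[of n x] j by simp
      qed
      then show "(\<lambda>n. u n x) \<longlonglongrightarrow> h x"
        by (intro tendsto_eventually eventually_sequentiallyI[of "max j k"])
    qed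
  qed
  from order_tendstoD(2)[OF this r] obtain n where "local_dist M U (u n) h < r"
    by (auto simp: eventually_sequentially)
  then show "\<exists>u\<in>{u. superharmonic M E u}. local_dist M U u h < r" using u by blast
qed

end

theorem theorem2p57:
  fixes M :: "'a measure" and E :: "('a \<Rightarrow> real) \<Rightarrow> ennreal" and h :: "'a \<Rightarrow> real"
  assumes "localizable M"
    and "energy_form M E"
    and "full_support M E"
    and "h \<in> borel_measurable M"
  shows "excessive M E h \<longleftrightarrow> (\<forall>f\<in>form_domain M E. E (\<lambda>x. min (f x) (h x)) \<le> E f)"
proof -
  interpret energy_form_on M E
    using assms(1,2) by unfold_locales (auto simp: localizable_def energy_form_def)
  show ?thesis
    using excessive_min_le excessiveI assms(3,4) by blast
qed

end
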